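(* Let $\mathcal{O}=\{t_1,\dots,t_\mu\}$ be an order ideal in $\mathbb{T}^n$, let $\mathcal{H}$ be an $(n,\mu)$-admissible Hilbert function which dominates $\mathrm{HF}^a_{\mathcal{O}}$, and let $\mathcal{O}'=\{t'_1,\dots,t'_\mu\}$ be an order ideal in $\mathbb{T}^n$ such that $\mathrm{HF}^a_{\mathcal{O}'}=\mathcal{H}$. Let $T'\in\mathrm{Mat}_\mu(K[C])$ be the matrix whose $i$-th column is the first column of $t'_i(\mathcal{A}_1,\dots,\mathcal{A}_n)$ for $i=1,\dots,\mu$, where $\mathcal{A}_1,\dots,\mathcal{A}_n$ are the generic multiplication matrices for $\mathcal{O}$. Let $$I^{\mathrm{dfb}}_{\mathcal{O}\mathcal{O}'}=I(Z_{\mathcal{O}}(\overline{\mathcal{H}}))\cap\langle\det(T')\rangle\quad\text{and}\quad J_{\mathcal{O}'}=I^{\mathrm{dfb}}_{\mathcal{O}\mathcal{O}'}+I(\mathbb{B}_{\mathcal{O}}(\overline{\mathcal{H}})).$$ Then $$\mathbb{B}^{\mathrm{dfb}}_{\mathcal{O}}(\mathcal{O}')=\mathbb{B}_{\mathcal{O}}(\overline{\mathcal{H}})\setminus\mathcal{Z}(J_{\mathcal{O}'})=\mathbb{B}_{\mathcal{O}}(\mathcal{H})\setminus\mathcal{Z}(\det(T')).$$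
   Context: $K$ is an arbitrary field, $P=K[x_1,\dots,x_n]$, and $\mathbb{T}^n$ is the monoid of terms (power products) in $x_1,\dots,x_n$. An order ideal is a finite set $\mathcal{O}=\{t_1,\dots,t_\mu\}\subset\mathbb{T}^n$ with $\mu\ge 1$ containing every divisor in $\mathbb{T}^n$ of each of its elements; it is always ordered so that $\deg(t_1)\le\cdots\le\deg(t_\mu)$, hence $t_1=1$. Its border is $\partial\mathcal{O}=(x_1\mathcal{O}\cup\cdots\cup x_n\mathcal{O})\setminus\mathcal{O}=\{b_1,\dots,b_\nu\}$, and its affine Hilbert function is $\mathrm{HF}^a_{\mathcal{O}}(i)=\#\{j\mid\deg(t_j)\le i\}$. Let $C=\{c_{ij}\mid 1\le i\le\mu,\ 1\le j\le\nu\}$ be new indeterminates. The $r$-th generic multiplication matrix $\mathcal{A}_r=(a^{(r)}_{ij})\in\mathrm{Mat}_\mu(K[C])$ has $a^{(r)}_{ij}=\delta_{im}$ if $x_rt_j=t_m$ and $a^{(r)}_{ij}=c_{im}$ if $x_rt_j=b_m$. $I(\mathbb{B}_{\mathcal{O}})\subseteq K[C]$ is generated by the entries of all commutators $\mathcal{A}_r\mathcal{A}_s-\mathcal{A}_s\mathcal{A}_r$, and the border basis scheme $\mathbb{B}_{\mathcal{O}}\subseteq\mathrm{Spec}(K[C])$ is the closed subscheme it defines. For a $K$-rational point $\Gamma=(\gamma_{ij})$ of $\mathbb{B}_{\mathcal{O}}$, let $I_\Gamma\subset P$ be generated by $b_j-\sum_i\gamma_{ij}t_i$; $\Gamma$ represents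 the 0-dimensional scheme $\mathbb{X}_\Gamma\subset\mathbb{A}^n_K$ with vanishing ideal $I_\Gamma$, and $R_\Gamma=P/I_\Gamma$. For a 0-dimensional $\mathbb{X}\subset\mathbb{A}^n_K$ with $R_{\mathbb{X}}=P/I_{\mathbb{X}}$, let $F_iR_{\mathbb{X}}$ be the image of the polynomials of degree $\le i$; $\mathrm{HF}^a_{\mathbb{X}}(i)=\mathrm{HF}^a_{R_{\mathbb{X}}}(i)=\dim_K F_iR_{\mathbb{X}}$. An order ideal $\mathcal{O}'$ is a degree filtered $K$-basis of $R_{\mathbb{X}}$ if for every $i\ge 0$ the residue classes of its elements of degree $\le i$ form a $K$-basis of $F_iR_{\mathbb{X}}$. For a term $t=x_1^{\alpha_1}\cdots x_n^{\alpha_n}$, $t(\mathcal{A}_1,\dots,\mathcal{A}_n)=\mathcal{A}_1^{\alpha_1}\cdots\mathcal{A}_n^{\alpha_n}$. A sequence $(H_i)$ dominates $(H'_i)$ if $H_i\ge H'_i$ for all $i\ge 0$ (strictly, if they moreover differ); $\mathcal{H}=(H_0,H_1,\dots)$ is $(n,\mu)$-admissible if $\mathcal{H}=\mathrm{HF}^a_{\mathbb{X}}$ for some 0-dimensional $\mathbb{X}\subset\mathbb{A}^n_K$ of length $\mu$. $\mathbb{B}_{\mathcal{O}}(\overline{\mathcal{H}})$ is the closed subscheme of $\mathbb{B}_{\mathcal{O}}$ which is the closure of the set of $K$-rational points $\Gamma$ with $\mathrm{HF}^a_{R_\Gamma}$ dominated by $\mathcal{H}$; $\mathbb{B}_{\mathcal{O}}(\mathcal{H})$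 is the complement in it of the closure of the set of those $\Gamma$ with $\mathrm{HF}^a_{R_\Gamma}$ strictly dominated by $\mathcal{H}$ (so its $K$-rational points are the $\Gamma$ with $\mathrm{HF}^a_{R_\Gamma}=\mathcal{H}$). $\mathbb{B}^{\mathrm{dfb}}_{\mathcal{O}}(\mathcal{O}')$, the $\mathcal{O}'$-DFB subscheme, is the open subscheme of $\mathbb{B}_{\mathcal{O}}(\mathcal{H})$, with $\mathcal H=\mathrm{HF}^a_{\mathcal{O}'}$, whose $K$-rational points represent the schemes $\mathbb{X}$ such that $\mathcal{O}'$ is a degree filtered $K$-basis of $R_{\mathbb{X}}$ (possibly empty). Ideals: for a sequence $\mathcal{G}=(G_0,G_1,\dots)$ dominating $\mathrm{HF}^a_{\mathcal{O}}$ with $\sigma=\min\{i\mid G_i=\mu\}$, $I(\mathbb{B}_{\mathcal{O}}(\overline{\mathcal{G}}))=I(\mathbb{B}_{\mathcal{O}})+\sum_{i=1}^{\sigma-1}D_i$, where $D_i$ is generated by the minors of size $G_i+1$ of the matrix whose columns are the first columns of $u(\mathcal{A}_1,\dots,\mathcal{A}_n)$, $u$ ranging over the terms of degree $\le i$ (minors of size exceeding the matrix contribute the zero ideal). With $\rho=\min\{i\mid H_i=\mu\}$ and $\mathcal{H}'_i$ obtained from $\mathcal{H}$ by replacing $H_i$ with $H_i-1$, $I(Z_{\mathcal{O}}(\overline{\mathcal{H}}))=\bigcap I(\mathbb{B}_{\mathcal{O}}(\overline{\mathcal{H}'_i}))$, where the intersection is over $i\in\{1,\dots,\rho\}$ with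 $H_i-1\ge\mathrm{HF}^a_{\mathcal{O}}(i)$ (empty intersection $=\langle 1\rangle$). $\mathcal{Z}(\cdot)$ is the zero locus in $\mathrm{Spec}(K[C])$. Conventions: $K$-rational points are to be read as $L$-rational points over field extensions $L\supseteq K$, e.g. $L=\overline{K}$ (in particular closures are formed using $\overline{K}$-rational points); subschemes and their defining ideals are considered up to radical. *)

theory Defs
  imports
    "HOL-Analysis.Analysis"
    "HOL-Library.Poly_Mapping"
    "HOL-Algebra.QuotRing"
    "HOL-Algebra.Embedded_Algebras"
    "HOL-Algebra.Algebraic_Closure_Type"
    "Jordan_Normal_Form.Determinant"
begin

no_notation vec_index (infixl "$" 100)

section \<open>Terms, polynomials, order ideals\<close>

text \<open>
  A term is its exponent vector, so multiplication of terms is addition. The polynomial ring in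
  the indeterminates indexed by a type is the type of polynomials itself; its ideals are the
  ideals of the ring structure \<^const>\<open>ring_of_type_algebra\<close> on that type.
\<close>

type_synonym 'v pterm = "'v \<Rightarrow>\<^sub>0 nat"
type_synonym ('v, 'k) mpoly = "'v pterm \<Rightarrow>\<^sub>0 'k"

abbreviation pring :: "'a::comm_ring_1 ring"
  where "pring \<equiv> ring_of_type_algebra"

definition tdeg :: "'v pterm \<Rightarrow> nat"
  where "tdeg u = (\<Sum>x\<in>Poly_Mapping.keys u. Poly_Mapping.lookup u x)"

definition pterm_var :: "'v \<Rightarrow> 'v pterm"
  where "pterm_var x = Poly_Mapping.single x 1"

definition pconst :: "'k \<Rightarrow> ('v, 'k::comm_ring_1) mpoly"
  where "pconst c = Poly_Mapping.single 0 c"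

definition pmonom :: "'v pterm \<Rightarrow> ('v, 'k::comm_ring_1) mpoly"
  where "pmonom u = Poly_Mapping.single u 1"

definition pvar :: "'v \<Rightarrow> ('v, 'k::comm_ring_1) mpoly"
  where "pvar x = pmonom (pterm_var x)"

definition order_ideal :: "'n pterm set \<Rightarrow> bool"
  where "order_ideal \<O> \<longleftrightarrow> finite \<O> \<and> \<O> \<noteq> {} \<and> (\<forall>u\<in>\<O>. \<forall>s w. u = s + w \<longrightarrow> s \<in> \<O>)"

text \<open>\<open>t\<close> lists the elements of an order ideal by nondecreasing degree.\<close>

definition order_ideal_enum :: "('m::{finite,linorder} \<Rightarrow> 'n pterm) \<Rightarrow> bool"
  where "order_ideal_enum t \<longleftrightarrow> order_ideal (range t) \<and> inj t \<and> mono (\<lambda>i. tdeg (t i))"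

definition border :: "'n pterm set \<Rightarrow> 'n pterm set"
  where "border \<O> = (\<Union>x. (\<lambda>u. pterm_var x + u) ` \<O>) - \<O>"

definition HF_ord :: "'n pterm set \<Rightarrow> nat \<Rightarrow> nat"
  where "HF_ord \<O> i = card {u \<in> \<O>. tdeg u \<le> i}"


section \<open>Affine Hilbert functions of residue class rings\<close>

definition residue_ring :: "('n, 'l::field) mpoly set \<Rightarrow> ('n, 'l) mpoly set ring"
  where "residue_ring I = pring Quot I"

definition residue :: "('n, 'l::field) mpoly set \<Rightarrow> ('n, 'l) mpoly \<Rightarrow> ('n, 'l) mpoly set"
  where "residue I p = I +>\<^bsub>pring\<^esub> p"

text \<open>The image of the ground field in the residue class ring.\<close>

definition scalars :: "('n, 'l::field) mpoly set \<Rightarrow> ('n, 'l) mpoly set set"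
  where "scalars I = range (\<lambda>c. residue I (pconst c))"

definition degree_filt :: "('n, 'l::field) mpoly set \<Rightarrow> nat \<Rightarrow> ('n, 'l) mpoly set set"
  where "degree_filt I i = residue I ` {p. \<forall>u\<in>Poly_Mapping.keys p. tdeg u \<le> i}"

definition HFa :: "('n, 'l::field) mpoly set \<Rightarrow> nat \<Rightarrow> nat"
  where "HFa I i = ring.dim (residue_ring I) (scalars I) (degree_filt I i)"

text \<open>A 0-dimensional subscheme of affine space is given by its vanishing ideal.\<close>

definition zero_dim_ideal :: "nat \<Rightarrow> ('n, 'l::field) mpoly set \<Rightarrow> bool"
  where "zero_dim_ideal \<mu> I \<longleftrightarrow>
    ideal I pring \<and>
    ring.dimension (residue_ring I) \<mu> (scalars I) (carrier (residue_ring I))"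

definition admissible :: "('n, 'k::field) mpoly itself \<Rightarrow> nat \<Rightarrow> (nat \<Rightarrow> nat) \<Rightarrow> bool"
  where "admissible _ \<mu> H \<longleftrightarrow> (\<exists>I :: ('n, 'k) mpoly set. zero_dim_ideal \<mu> I \<and> HFa I = H)"

definition degree_filtered_basis :: "'n pterm set \<Rightarrow> ('n, 'l::field) mpoly set \<Rightarrow> bool"
  where "degree_filtered_basis \<O> I \<longleftrightarrow>
    (\<forall>i. \<exists>us. distinct us \<and> set us = {u \<in> \<O>. tdeg u \<le> i} \<and>
      (let rs = map (\<lambda>u. residue I (pmonom u)) us in
        ring.independent (residue_ring I) (scalars I) rs \<and>
        ring.Span (residue_ring I) (scalars I) rs = degree_filt I i))"


section \<open>The spectrum of a ring\<close>

text \<open>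
  Subschemes are considered up to radical: a closed subscheme is a closed subset of the
  spectrum, and an open subscheme of a locally closed one is a relatively open subset.
\<close>

definition Spec :: "('a, 'c) ring_scheme \<Rightarrow> 'a set set"
  where "Spec R = {\<pp>. primeideal \<pp> R}"

definition zero_locus :: "('a, 'c) ring_scheme \<Rightarrow> 'a set \<Rightarrow> 'a set set"
  where "zero_locus R S = {\<pp> \<in> Spec R. S \<subseteq> \<pp>}"

definition zariski :: "('a, 'c) ring_scheme \<Rightarrow> 'a set topology"
  where "zariski R = topology (\<lambda>U. \<exists>S \<subseteq> carrier R. U = Spec R - zero_locus R S)"

lemma istopology_zariski:
  "istopology (\<lambda>U. \<exists>S \<subseteq> carrier R. U = Spec R - zero_locus R S)"
  unfolding istopology_def
proof (intro conjI allI impI)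
  fix U V
  assume "\<exists>S \<subseteq> carrier R. U = Spec R - zero_locus R S"
    and "\<exists>S \<subseteq> carrier R. V = Spec R - zero_locus R S"
  then obtain S T where S: "S \<subseteq> carrier R" "U = Spec R - zero_locus R S"
    and T: "T \<subseteq> carrier R" "V = Spec R - zero_locus R T"
    by blast
  show "\<exists>S \<subseteq> carrier R. U \<inter> V = Spec R - zero_locus R S"
  proof (cases "\<exists>\<pp>. primeideal \<pp> R")
    case False
    then show ?thesis
      using S T by (auto simp: Spec_def)
  next
    case True
    then obtain \<qq> where "primeideal \<qq> R" ..
    then interpret Q: primeideal \<qq> R .
    let ?P = "{s \<otimes>\<^bsub>R\<^esub> u | s u. s \<in> S \<and> u \<in> T}"
    have P: "?P \<subseteq> carrier R"
      using S(1) T(1) by auto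
    have "(?P \<subseteq> \<pp>) \<longleftrightarrow> (S \<subseteq> \<pp> \<or> T \<subseteq> \<pp>)" if "primeideal \<pp> R" for \<pp>
    proof -
      interpret P: primeideal \<pp> R by fact
      show ?thesis
      proof
        assume le: "?P \<subseteq> \<pp>"
        show "S \<subseteq> \<pp> \<or> T \<subseteq> \<pp>"
        proof (rule ccontr)
          assume "\<not> (S \<subseteq> \<pp> \<or> T \<subseteq> \<pp>)"
          then obtain s u where "s \<in> S" "s \<notin> \<pp>" "u \<in> T" "u \<notin> \<pp>" by blast
          moreover from this have "s \<otimes>\<^bsub>R\<^esub> u \<in> \<pp>" using le by blast
          ultimately show False using P.I_prime S(1) T(1) by blast
        qed
      next
        assume "S \<subseteq> \<pp> \<or> T \<subseteq> \<pp>"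
        then show "?P \<subseteq> \<pp>"
        proof
          assume "S \<subseteq> \<pp>" then show ?thesis using T(1) P.I_r_closed by blast
        next
          assume "T \<subseteq> \<pp>" then show ?thesis using S(1) P.I_l_closed by blast
        qed
      qed
    qed
    then have "zero_locus R ?P = zero_locus R S \<union> zero_locus R T"
      unfolding Spec_def zero_locus_def by blast
    with P S(2) T(2) show ?thesis
      by (intro exI[of _ ?P]) blast
  qed
next
  fix \<U> assume "\<forall>U\<in>\<U>. \<exists>S \<subseteq> carrier R. U = Spec R - zero_locus R S"
  then obtain f where f: "\<And>U. U \<in> \<U> \<Longrightarrow> f U \<subseteq> carrier R \<and> U = Spec R - zero_locus R (f U)"
    by metis
  have "\<Union>\<U> = Spec R - zero_locus R (\<Union>U\<in>\<U>. f U)"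
    using f unfolding zero_locus_def by blast
  then show "\<exists>S \<subseteq> carrier R. \<Union>\<U> = Spec R - zero_locus R S"
    using f by (intro exI[of _ "\<Union>U\<in>\<U>. f U"]) blast
qed

text \<open>
  Points with coordinates in the algebraic closure of the ground field: evaluation, and the
  image of such a point in the spectrum.
\<close>

definition eval_at :: "('v \<Rightarrow> 'k alg_closure) \<Rightarrow> ('v, 'k::field) mpoly \<Rightarrow> 'k alg_closure"
  where "eval_at \<gamma> f = (\<Sum>u\<in>Poly_Mapping.keys f. to_ac (Poly_Mapping.lookup f u) *
    (\<Prod>x\<in>Poly_Mapping.keys u. \<gamma> x ^ Poly_Mapping.lookup u x))"

definition spec_point :: "('v \<Rightarrow> 'k alg_closure) \<Rightarrow> ('v, 'k::field) mpoly set"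
  where "spec_point \<gamma> = {f. eval_at \<gamma> f = 0}"


section \<open>The border basis scheme\<close>

text \<open>
  The enumerations \<open>t\<close> and \<open>b\<close> of the order ideal and of its border are indexed by
  finite types \<open>'m\<close> and \<open>'b\<close>; the indeterminate \<open>c\<^sub>i\<^sub>j\<close> is the one with index \<open>(i, j)\<close>.
\<close>

definition generic_mult_mat ::
  "('m::finite \<Rightarrow> 'n pterm) \<Rightarrow> ('b \<Rightarrow> 'n pterm) \<Rightarrow> 'n \<Rightarrow> ('m \<times> 'b, 'k::field) mpoly ^ 'm ^ 'm"
  where "generic_mult_mat t b r = (\<chi> i j.
    let u = pterm_var r + t j in
      if u \<in> range t then (if t i = u then 1 else 0) else pvar (i, inv_into UNIV b u))"

definition bb_ideal ::
  "('m::finite \<Rightarrow> 'n pterm) \<Rightarrow> ('b \<Rightarrow> 'n pterm) \<Rightarrow> ('m \<times> 'b, 'k::field) mpoly set"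
  where "bb_ideal t b = Idl\<^bsub>pring\<^esub>
    {(generic_mult_mat t b r ** generic_mult_mat t b s -
      generic_mult_mat t b s ** generic_mult_mat t b r) $ i $ j | r s i j. True}"

definition bb_points ::
  "('m::finite \<Rightarrow> 'n pterm) \<Rightarrow> ('b \<Rightarrow> 'n pterm) \<Rightarrow> ('m \<times> 'b \<Rightarrow> 'k::field alg_closure) set"
  where "bb_points t b = {\<gamma>. \<forall>f \<in> bb_ideal t b. eval_at \<gamma> f = 0}"

definition point_ideal ::
  "('m::finite \<Rightarrow> 'n pterm) \<Rightarrow> ('b \<Rightarrow> 'n pterm) \<Rightarrow> ('m \<times> 'b \<Rightarrow> 'l::field) \<Rightarrow> ('n, 'l) mpoly set"
  where "point_ideal t b \<gamma> = Idl\<^bsub>pring\<^esub>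
    (range (\<lambda>j. pmonom (b j) - (\<Sum>i\<in>UNIV. pconst (\<gamma> (i, j)) * pmonom (t i))))"

text \<open>The order on functions is pointwise, so \<open>\<le>\<close> and \<open><\<close> are (strict) domination.\<close>

definition HF_closed_sub ::
  "('m::finite \<Rightarrow> 'n pterm) \<Rightarrow> ('b \<Rightarrow> 'n pterm) \<Rightarrow> (nat \<Rightarrow> nat) \<Rightarrow>
   ('m \<times> 'b, 'k::field) mpoly set set"
  where "HF_closed_sub t b H =
    zariski pring closure_of (spec_point ` {\<gamma> \<in> bb_points t b. HFa (point_ideal t b \<gamma>) \<le> H})"

definition HF_sub ::
  "('m::finite \<Rightarrow> 'n pterm) \<Rightarrow> ('b \<Rightarrow> 'n pterm) \<Rightarrow> (nat \<Rightarrow> nat) \<Rightarrow>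
   ('m \<times> 'b, 'k::field) mpoly set set"
  where "HF_sub t b H = HF_closed_sub t b H -
    zariski pring closure_of (spec_point ` {\<gamma> \<in> bb_points t b. HFa (point_ideal t b \<gamma>) < H})"

text \<open>
  The DFB subscheme is singled out among the open subschemes of \<^const>\<open>HF_sub\<close> by its
  points over the algebraic closure.
\<close>

definition is_dfb_sub ::
  "('m::finite \<Rightarrow> 'n pterm) \<Rightarrow> ('b \<Rightarrow> 'n pterm) \<Rightarrow> 'n pterm set \<Rightarrow>
   ('m \<times> 'b, 'k::field) mpoly set set \<Rightarrow> bool"
  where "is_dfb_sub t b \<O>' U \<longleftrightarrow>
    openin (subtopology (zariski pring) (HF_sub t b (HF_ord \<O>'))) U \<and>
    (\<forall>\<gamma> \<in> bb_points t b. spec_point \<gamma> \<in> U \<longleftrightarrow> degree_filtered_basis \<O>' (point_ideal t b \<gamma>))"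

definition dfb_sub ::
  "('m::finite \<Rightarrow> 'n pterm) \<Rightarrow> ('b \<Rightarrow> 'n pterm) \<Rightarrow> 'n pterm set \<Rightarrow>
   ('m \<times> 'b, 'k::field) mpoly set set"
  where "dfb_sub t b \<O>' = (THE U. is_dfb_sub t b \<O>' U)"


section \<open>Determinantal ideals\<close>

definition mat_pow :: "'a::comm_ring_1 ^ 'm ^ 'm \<Rightarrow> nat \<Rightarrow> 'a ^ 'm ^ 'm"
  where "mat_pow A k = ((\<lambda>B. A ** B) ^^ k) (Finite_Cartesian_Product.mat 1)"

text \<open>
  The value \<open>A\<^sub>1\<^sup>\<alpha>\<^sup>1 \<cdots> A\<^sub>n\<^sup>\<alpha>\<^sup>n\<close> of a term; the generic multiplication matrices need not commute,
  so the order of the factors matters.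
\<close>

definition term_mat ::
  "('n::{finite,linorder} \<Rightarrow> 'a::comm_ring_1 ^ 'm ^ 'm) \<Rightarrow> 'n pterm \<Rightarrow> 'a ^ 'm ^ 'm"
  where "term_mat A u =
    foldr (\<lambda>x M. mat_pow (A x) (Poly_Mapping.lookup u x) ** M) (sorted_list_of_set UNIV) (Finite_Cartesian_Product.mat 1)"

definition first_column_entry ::
  "('m::{finite,linorder} \<Rightarrow> 'n::{finite,linorder} pterm) \<Rightarrow> ('b \<Rightarrow> 'n pterm) \<Rightarrow>
   'n pterm \<Rightarrow> 'm \<Rightarrow> ('m \<times> 'b, 'k::field) mpoly"
  where "first_column_entry t b u i = term_mat (generic_mult_mat t b) u $ i $ Min UNIV"

text \<open>
  The minors of size \<open>k\<close> of the matrix of first columns of \<open>u(A)\<close>, \<open>deg u \<le> d\<close>; \<open>p\<close> and \<open>q\<close>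
  select the rows and columns.
\<close>

definition minors ::
  "('m::{finite,linorder} \<Rightarrow> 'n::{finite,linorder} pterm) \<Rightarrow> ('b \<Rightarrow> 'n pterm) \<Rightarrow>
   nat \<Rightarrow> nat \<Rightarrow> ('m \<times> 'b, 'k::field) mpoly set"
  where "minors t b d k =
    {Determinant.det (Matrix.mat k k (\<lambda>(x, y). first_column_entry t b (q y) (p x))) | p q.
      inj_on p {..<k} \<and> inj_on q {..<k} \<and> q ` {..<k} \<subseteq> {u. tdeg u \<le> d}}"

definition HF_ideal ::
  "('m::{finite,linorder} \<Rightarrow> 'n::{finite,linorder} pterm) \<Rightarrow> ('b \<Rightarrow> 'n pterm) \<Rightarrow>
   (nat \<Rightarrow> nat) \<Rightarrow> ('m \<times> 'b, 'k::field) mpoly set"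
  where "HF_ideal t b G = Idl\<^bsub>pring\<^esub>
    (bb_ideal t b \<union>
      (\<Union>i \<in> {1..<(LEAST i. G i = CARD('m))}. Idl\<^bsub>pring\<^esub> (minors t b i (G i + 1))))"

definition Z_ideal ::
  "('m::{finite,linorder} \<Rightarrow> 'n::{finite,linorder} pterm) \<Rightarrow> ('b \<Rightarrow> 'n pterm) \<Rightarrow>
   (nat \<Rightarrow> nat) \<Rightarrow> ('m \<times> 'b, 'k::field) mpoly set"
  where "Z_ideal t b H =
    (\<Inter>i \<in> {i \<in> {1..(LEAST i. H i = CARD('m))}. HF_ord (range t) i \<le> H i - 1}.
      HF_ideal t b (H(i := H i - 1)))"

definition T_det ::
  "('m::{finite,linorder} \<Rightarrow> 'n::{finite,linorder} pterm) \<Rightarrow> ('b \<Rightarrow> 'n pterm) \<Rightarrow>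
   ('m \<Rightarrow> 'n pterm) \<Rightarrow> ('m \<times> 'b, 'k::field) mpoly"
  where "T_det t b t' = Determinants.det (\<chi> i j. first_column_entry t b (t' j) i)"

definition dfb_ideal ::
  "('m::{finite,linorder} \<Rightarrow> 'n::{finite,linorder} pterm) \<Rightarrow> ('b \<Rightarrow> 'n pterm) \<Rightarrow>
   ('m \<Rightarrow> 'n pterm) \<Rightarrow> (nat \<Rightarrow> nat) \<Rightarrow> ('m \<times> 'b, 'k::field) mpoly set"
  where "dfb_ideal t b t' H = Z_ideal t b H \<inter> Idl\<^bsub>pring\<^esub> {T_det t b t'}"

definition J_ideal ::
  "('m::{finite,linorder} \<Rightarrow> 'n::{finite,linorder} pterm) \<Rightarrow> ('b \<Rightarrow> 'n pterm) \<Rightarrow>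
   ('m \<Rightarrow> 'n pterm) \<Rightarrow> (nat \<Rightarrow> nat) \<Rightarrow> ('m \<times> 'b, 'k::field) mpoly set"
  where "J_ideal t b t' H = dfb_ideal t b t' H <+>\<^bsub>pring\<^esub> HF_ideal t b H"

end

theory Submission
  imports Defs
begin

text \<open>
  All the subschemes involved are determined by their points over the algebraic closure, so the
  proof consists of three comparisons at points and one principle that transports them to the
  spectrum.

  The principle is the Nullstellensatz (\<open>nullstellensatz\<close>): if a polynomial is outside a prime \<open>P\<close>,
  some geometric point of \<open>P\<close> does not annihilate it. It is proved by adjoining the variables one at
  a time (\<open>separated_adjoin\<close>). Consequently the closure of the set of points satisfying given
  equations is the zero locus of these equations (\<open>closure_of_points\<close>), and an open subset of
  \<open>HF_sub\<close> is determined by its geometric points (\<open>open_sub_determined_by_points\<close>), which makes the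
  DFB subscheme well defined.

  At a point \<open>\<gamma>\<close> of the border basis scheme the multiplication matrices commute, and applying a
  polynomial in them to the first unit vector identifies the residue class ring with the space of
  column vectors (\<open>in_I_iff\<close>). The terms of degree at most \<open>d\<close> go to the first columns that occur in
  the determinantal ideals, so the Hilbert function in degree \<open>d\<close> is the dimension of the span of
  these columns (\<open>HFa_eq_dim\<close>), and bounding it means that minors vanish (\<open>le_dim_iff_minor\<close>). This
  gives the first two comparisons: the points with Hilbert function at most \<open>H\<close> are the zeros of
  \<open>HF_ideal\<close> (\<open>HF_ideal_vanishes_iff\<close>), and those with Hilbert function strictly below \<open>H\<close> are the
  zeros of \<open>Z_ideal\<close>, because a defect must occur in one of finitely many degrees
  (\<open>Z_ideal_vanishes_iff\<close>). Hence \<open>HF_sub\<close> is the zero locus of \<open>HF_ideal\<close> minus that of \<open>Z_ideal\<close>.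

  The third comparison: for a point with Hilbert function \<open>H\<close>, the order ideal \<open>range t'\<close> is a degree
  filtered basis iff its columns are independent, since it has the right number of terms in each
  degree; and independence means that \<open>T_det\<close> does not vanish (\<open>degree_filtered_basis_point_iff\<close>).
  So the DFB subscheme is \<open>HF_sub\<close> minus the zero locus of \<open>T_det\<close>. The zero locus of \<open>J_ideal\<close> is
  computed prime by prime (\<open>zero_locus_J\<close>), which yields the other description.
\<close>

section \<open>Extending points along a finitely generated extension\<close>

alias coeff = Polynomial.coeff
alias degree = Polynomial.degree
alias monom = Polynomial.monom
alias lead_coeff = Polynomial.lead_coeff
alias smult = Polynomial.smult

definition polys_over :: "'r::comm_ring_1 set \<Rightarrow> 'r poly set"
  where "polys_over A = {G. \<forall>i. coeff G i \<in> A}"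

definition adjoin :: "'r::comm_ring_1 set \<Rightarrow> 'r \<Rightarrow> 'r set"
  where "adjoin A x = (\<lambda>G. poly G x) ` polys_over A"

text \<open>
  The domain that matters is the image of \<open>A\<close> modulo the prime \<open>P\<close>. Computing modulo \<open>P\<close> in a
  fixed ambient ring, instead of passing to that quotient, lets \<open>A\<close> grow one generator at a time
  within a single type.
\<close>

locale prime_on_subring =
  fixes A P :: "'r::comm_ring_1 set"
  assumes one_A: "1 \<in> A"
    and diff_A: "\<And>x y. x \<in> A \<Longrightarrow> y \<in> A \<Longrightarrow> x - y \<in> A"
    and mult_A: "\<And>x y. x \<in> A \<Longrightarrow> y \<in> A \<Longrightarrow> x * y \<in> A"
    and one_P: "1 \<notin> P"
    and diff_P: "\<And>x y. x \<in> P \<Longrightarrow> y \<in> P \<Longrightarrow> x - y \<in> P"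
    and zero_P: "0 \<in> P"
    and mult_P: "\<And>x y. y \<in> P \<Longrightarrow> x * y \<in> P"
    and prime_P: "\<And>x y. x * y \<in> P \<Longrightarrow> x \<in> P \<or> y \<in> P"
begin

lemma zero_A: "0 \<in> A"
  using diff_A[OF one_A one_A] by simp

lemma uminus_A: "x \<in> A \<Longrightarrow> - x \<in> A"
  using diff_A[OF zero_A] by fastforce

lemma add_A: "x \<in> A \<Longrightarrow> y \<in> A \<Longrightarrow> x + y \<in> A"
  using diff_A[of x "- y"] uminus_A by simp

lemma sum_A: "(\<And>i. i \<in> S \<Longrightarrow> f i \<in> A) \<Longrightarrow> sum f S \<in> A"
  by (induction S rule: infinite_finite_induct) (auto simp: zero_A add_A)

lemma power_A: "x \<in> A \<Longrightarrow> x ^ k \<in> A"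
  by (induction k) (auto simp: one_A mult_A)

lemma uminus_P: "x \<in> P \<Longrightarrow> - x \<in> P"
  using diff_P[OF zero_P] by fastforce

lemma add_P: "x \<in> P \<Longrightarrow> y \<in> P \<Longrightarrow> x + y \<in> P"
  using diff_P[of x "- y"] uminus_P by simp

lemma mult_P': "x \<in> P \<Longrightarrow> x * y \<in> P"
  using mult_P[of x y] by (simp add: mult.commute)

lemma sum_P: "(\<And>i. i \<in> S \<Longrightarrow> f i \<in> P) \<Longrightarrow> sum f S \<in> P"
  by (induction S rule: infinite_finite_induct) (auto simp: zero_P add_P)

lemma power_P: "x ^ k \<in> P \<Longrightarrow> x \<in> P"
  using one_P prime_P by (induction k) auto

lemma polys_0: "0 \<in> polys_over A"
  by (simp add: polys_over_def zero_A)

lemma polys_add: "F \<in> polys_over A \<Longrightarrow> G \<in> polys_over A \<Longrightarrow> F + G \<in> polys_over A"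
  by (simp add: polys_over_def add_A)

lemma polys_diff: "F \<in> polys_over A \<Longrightarrow> G \<in> polys_over A \<Longrightarrow> F - G \<in> polys_over A"
  by (simp add: polys_over_def diff_A)

lemma polys_mult: "F \<in> polys_over A \<Longrightarrow> G \<in> polys_over A \<Longrightarrow> F * G \<in> polys_over A"
  by (simp add: polys_over_def coeff_mult sum_A mult_A)

lemma polys_monom: "a \<in> A \<Longrightarrow> monom a n \<in> polys_over A"
  by (simp add: polys_over_def zero_A)

lemma polys_const: "a \<in> A \<Longrightarrow> [:a:] \<in> polys_over A"
  using polys_monom[of a 0] by (simp add: monom_0)

lemma polys_smult: "a \<in> A \<Longrightarrow> F \<in> polys_over A \<Longrightarrow> smult a F \<in> polys_over A"
  by (simp add: polys_over_def mult_A)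

lemma poly_in_P: "(\<And>i. coeff F i \<in> P) \<Longrightarrow> poly F x \<in> P"
  by (auto simp: poly_altdef intro!: sum_P mult_P')

lemma subring_adjoin: "prime_on_subring (adjoin A x) P"
proof unfold_locales
  show "1 \<in> adjoin A x"
    unfolding adjoin_def using polys_const[OF one_A] by (force intro!: image_eqI[of _ _ "[:1:]"])
  fix y z assume "y \<in> adjoin A x" "z \<in> adjoin A x"
  then obtain F G where "F \<in> polys_over A" "y = poly F x" "G \<in> polys_over A" "z = poly G x"
    by (auto simp: adjoin_def)
  then show "y - z \<in> adjoin A x"
    unfolding adjoin_def using polys_diff[of F G] by (auto intro!: image_eqI[of _ _ "F - G"])
  show "y * z \<in> adjoin A x"
    using \<open>F \<in> _\<close> \<open>y = _\<close> \<open>G \<in> _\<close> \<open>z = _\<close> unfolding adjoin_def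
    using polys_mult[of F G] by (auto intro!: image_eqI[of _ _ "F * G"])
qed (use one_P diff_P zero_P mult_P prime_P in auto)

lemma adjoin_subset: "A \<subseteq> adjoin A x"
proof
  fix a assume "a \<in> A"
  then show "a \<in> adjoin A x"
    unfolding adjoin_def using polys_const[of a] by (force intro!: image_eqI[of _ _ "[:a:]"])
qed

lemma adjoin_self: "x \<in> adjoin A x"
  unfolding adjoin_def using polys_monom[OF one_A, of 1]
  by (force simp: poly_monom intro!: image_eqI[of _ _ "monom 1 1"])

text \<open>
  The bound on the degree of \<open>q\<close> is what later forces a minimal degree to vanish: leading
  coefficients may be zero divisors, so it does not follow from the equation.
\<close>

lemma pseudo_division:
  assumes "G \<in> polys_over A" "F \<in> polys_over A" "G \<noteq> 0"
  obtains k q r where "q \<in> polys_over A" "r \<in> polys_over A"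
    "smult (lead_coeff G ^ k) F = q * G + r"
    "r = 0 \<or> degree r < degree G" "degree q \<le> degree F - degree G"
proof -
  let ?a = "lead_coeff G"
  have a: "?a \<in> A" using assms by (auto simp: polys_over_def)
  have "\<exists>k q r. q \<in> polys_over A \<and> r \<in> polys_over A \<and> smult (?a ^ k) F = q * G + r \<and>
    (r = 0 \<or> degree r < degree G) \<and> degree q \<le> degree F - degree G"
    using assms(2)
  proof (induction "degree F" arbitrary: F rule: less_induct)
    case less
    consider "degree F < degree G" | "degree F = 0" "degree G = 0" | "degree G \<le> degree F" "degree F > 0"
      by linarith
    then show ?case
    proof cases
      case 1
      then show ?thesis
        using less polys_0 by (intro exI[of _ 0] exI[of _ "0 :: 'r poly"] exI[of _ F]) auto
    next
      case 2
      then obtain u v where "F = [:u:]" "G = [:v:]" by (meson degree_eq_zeroE)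
      then show ?thesis
        using less polys_0 by (intro exI[of _ 1] exI[of _ F] exI[of _ "0 :: 'r poly"]) (auto simp: mult.commute)
    next
      case 3
      let ?d = "degree F - degree G"
      define M where "M = monom (lead_coeff F) ?d"
      have M: "M \<in> polys_over A" unfolding M_def
        using less by (intro polys_monom) (auto simp: polys_over_def)
      define F' where "F' = smult ?a F - M * G"
      have dM: "degree M \<le> ?d" by (simp add: M_def degree_monom_le)
      have F': "F' \<in> polys_over A"
        unfolding F'_def using less a assms M by (intro polys_diff polys_smult polys_mult)
      have "degree (M * G) \<le> degree F"
        using degree_mult_le[of M G] dM 3 by linarith
      then have "degree F' \<le> degree F"
        unfolding F'_def by (intro degree_diff_le) (auto intro: order_trans[OF degree_smult_le])
      moreover have "coeff (M * G) (degree F) = lead_coeff F * ?a"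
        using coeff_monom_mult[of "lead_coeff F" ?d G "degree F"] 3 unfolding M_def by simp
      then have "coeff F' (degree F) = 0"
        by (simp add: F'_def mult.commute)
      ultimately have deg: "degree F' < degree F"
        using 3 by (metis degree_0 leading_coeff_0_iff nat_less_le)
      obtain k q r where *: "q \<in> polys_over A" "r \<in> polys_over A" "smult (?a ^ k) F' = q * G + r"
        "r = 0 \<or> degree r < degree G" "degree q \<le> degree F' - degree G"
        using less.hyps[OF deg F'] by blast
      let ?q = "q + smult (?a ^ k) M"
      have "smult (?a ^ Suc k) F = smult (?a ^ k) F' + smult (?a ^ k) M * G"
        unfolding F'_def by (simp add: smult_diff_right mult.commute)
      also have "\<dots> = ?q * G + r" unfolding *(3) by (simp add: algebra_simps)
      finally have eq: "smult (?a ^ Suc k) F = ?q * G + r" .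
      have "degree ?q \<le> ?d"
        using * deg dM by (intro degree_add_le) (auto intro: order_trans[OF degree_smult_le])
      moreover have "?q \<in> polys_over A" using * M a power_A polys_add polys_smult by auto
      ultimately show ?thesis using eq * by blast
    qed
  qed
  then show ?thesis using that by blast
qed

text \<open>
  If \<open>S\<close> is stable under removing a leading term with coefficient in \<open>P\<close>, then an element that is
  nonzero modulo \<open>P\<close> and has minimal degree also has a leading coefficient that is nonzero modulo
  \<open>P\<close>; it can thus serve as a divisor in pseudo-division.
\<close>

lemma minimal_degree_outside:
  assumes S: "\<And>G. G \<in> S \<Longrightarrow> lead_coeff G \<in> P \<Longrightarrow> G - monom (lead_coeff G) (degree G) \<in> S"
    and ex: "G0 \<in> S" "coeff G0 i \<notin> P"
  obtains G where "G \<in> S" "lead_coeff G \<notin> P"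
    "\<And>G' j. G' \<in> S \<Longrightarrow> degree G' < degree G \<Longrightarrow> coeff G' j \<in> P"
proof -
  define Q where "Q G \<longleftrightarrow> G \<in> S \<and> (\<exists>i. coeff G i \<notin> P)" for G
  have "Q G0" using ex by (auto simp: Q_def)
  then obtain G where G: "Q G" and min: "\<And>G'. degree G' < degree G \<Longrightarrow> \<not> Q G'"
    using ex_has_least_nat[of Q G0 degree] by (metis linorder_not_less)
  obtain i where i: "coeff G i \<notin> P" using G by (auto simp: Q_def)
  have "lead_coeff G \<notin> P"
  proof
    assume lc: "lead_coeff G \<in> P"
    let ?H = "G - monom (lead_coeff G) (degree G)"
    have "i \<noteq> degree G" using i lc by auto
    then have "Q ?H" using S[of G] G lc i by (auto simp: Q_def intro!: exI[of _ i])
    moreover have "i \<le> degree G" using i zero_P by (metis le_degree)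
    then have "degree G > 0" using \<open>i \<noteq> degree G\<close> by linarith
    moreover have "degree ?H \<le> degree G" by (intro degree_diff_le degree_monom_le) auto
    moreover have "coeff ?H (degree G) = 0" by simp
    ultimately show False using min[of ?H] by (metis degree_0 leading_coeff_0_iff nat_less_le)
  qed
  then show ?thesis using that[of G] G min by (auto simp: Q_def)
qed

end

locale point_on_subring = prime_on_subring A P for A P :: "'r::comm_ring_1 set" +
  fixes \<phi> :: "'r \<Rightarrow> 'l::field"
  assumes hom_one: "\<phi> 1 = 1"
    and hom_add: "\<And>x y. x \<in> A \<Longrightarrow> y \<in> A \<Longrightarrow> \<phi> (x + y) = \<phi> x + \<phi> y"
    and hom_mult: "\<And>x y. x \<in> A \<Longrightarrow> y \<in> A \<Longrightarrow> \<phi> (x * y) = \<phi> x * \<phi> y"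
    and hom_P: "\<And>x. x \<in> A \<Longrightarrow> x \<in> P \<Longrightarrow> \<phi> x = 0"
begin

lemma hom_zero: "\<phi> 0 = 0"
  using hom_P zero_A zero_P by auto

lemma hom_sum: "(\<And>i. i \<in> S \<Longrightarrow> f i \<in> A) \<Longrightarrow> \<phi> (sum f S) = (\<Sum>i\<in>S. \<phi> (f i))"
  by (induction S rule: infinite_finite_induct) (auto simp: hom_zero hom_add sum_A)

lemma hom_power: "x \<in> A \<Longrightarrow> \<phi> (x ^ k) = \<phi> x ^ k"
  by (induction k) (auto simp: hom_one hom_mult power_A)

definition ev :: "'l \<Rightarrow> 'r poly \<Rightarrow> 'l"
  where "ev c G = poly (map_poly \<phi> G) c"

lemma ev_add: "F \<in> polys_over A \<Longrightarrow> G \<in> polys_over A \<Longrightarrow> ev c (F + G) = ev c F + ev c G"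
proof -
  assume "F \<in> polys_over A" "G \<in> polys_over A"
  then have "map_poly \<phi> (F + G) = map_poly \<phi> F + map_poly \<phi> G"
    by (intro poly_eqI) (auto simp: coeff_map_poly hom_zero hom_add polys_over_def)
  then show ?thesis by (simp add: ev_def)
qed

lemma ev_mult: "F \<in> polys_over A \<Longrightarrow> G \<in> polys_over A \<Longrightarrow> ev c (F * G) = ev c F * ev c G"
proof -
  assume "F \<in> polys_over A" "G \<in> polys_over A"
  then have "map_poly \<phi> (F * G) = map_poly \<phi> F * map_poly \<phi> G"
    by (intro poly_eqI)
      (auto simp: coeff_map_poly hom_zero hom_mult polys_over_def coeff_mult hom_sum mult_A)
  then show ?thesis by (simp add: ev_def)
qed

lemma ev_const: "ev c [:a:] = \<phi> a"
  by (simp add: ev_def map_poly_pCons hom_zero)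

lemma ev_diff: "F \<in> polys_over A \<Longrightarrow> G \<in> polys_over A \<Longrightarrow> ev c (F - G) = ev c F - ev c G"
  using ev_add[of "F - G" G c] polys_diff by (simp add: algebra_simps)

lemma ev_smult: "a \<in> A \<Longrightarrow> F \<in> polys_over A \<Longrightarrow> ev c (smult a F) = \<phi> a * ev c F"
  using ev_mult[of "[:a:]" F c] polys_const by (simp add: ev_const)

lemma ev_P: "F \<in> polys_over A \<Longrightarrow> (\<And>i. coeff F i \<in> P) \<Longrightarrow> ev c F = 0"
proof -
  assume "F \<in> polys_over A" "\<And>i. coeff F i \<in> P"
  then have "map_poly \<phi> F = 0"
    by (intro poly_eqI) (auto simp: coeff_map_poly hom_zero hom_P polys_over_def)
  then show ?thesis by (simp add: ev_def)
qed

text \<open>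
  The value of \<open>\<psi>\<close> on \<open>poly G x\<close> has to be \<open>ev c G\<close>. This is well defined because two
  representations of the same element differ by a polynomial whose value at \<open>x\<close> is 0, hence in
  \<open>P\<close>.
\<close>

lemma extend_point:
  assumes kill: "\<And>G. G \<in> polys_over A \<Longrightarrow> poly G x \<in> P \<Longrightarrow> ev c G = 0"
  obtains \<psi> where "point_on_subring (adjoin A x) P \<psi>" "\<And>a. a \<in> A \<Longrightarrow> \<psi> a = \<phi> a"
    "\<And>G. G \<in> polys_over A \<Longrightarrow> \<psi> (poly G x) = ev c G"
proof -
  define \<psi> where "\<psi> y = ev c (SOME G. G \<in> polys_over A \<and> poly G x = y)" for y
  have \<psi>: "\<psi> (poly G x) = ev c G" if "G \<in> polys_over A" for G
  proof -
    define Q where "Q H \<longleftrightarrow> H \<in> polys_over A \<and> poly H x = poly G x" for H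
    define G' where "G' = (SOME H. Q H)"
    have "Q G'" unfolding G'_def by (rule someI[of Q G]) (simp add: Q_def that)
    then have G': "G' \<in> polys_over A \<and> poly G' x = poly G x" by (simp add: Q_def)
    then have "ev c (G' - G) = 0" using kill[OF polys_diff[of G' G]] that zero_P by simp
    then show ?thesis using ev_diff[of G' G c] that G' by (simp add: \<psi>_def G'_def Q_def)
  qed
  have const: "\<psi> a = \<phi> a" if "a \<in> A" for a
    using \<psi>[OF polys_const[OF that]] by (simp add: ev_const)
  interpret E: prime_on_subring "adjoin A x" P by (rule subring_adjoin)
  have "point_on_subring (adjoin A x) P \<psi>"
  proof unfold_locales
    show "\<psi> 1 = 1" using const[OF one_A] by (simp add: hom_one)
  next
    fix y z assume "y \<in> adjoin A x" "z \<in> adjoin A x"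
    then obtain F G where FG: "F \<in> polys_over A" "y = poly F x" "G \<in> polys_over A" "z = poly G x"
      by (auto simp: adjoin_def)
    show "\<psi> (y + z) = \<psi> y + \<psi> z"
      using \<psi>[OF polys_add[of F G]] FG by (simp add: \<psi> ev_add)
    show "\<psi> (y * z) = \<psi> y * \<psi> z"
      using \<psi>[OF polys_mult[of F G]] FG by (simp add: \<psi> ev_mult)
  next
    fix y assume "y \<in> adjoin A x" "y \<in> P"
    then show "\<psi> y = 0" using kill \<psi> by (auto simp: adjoin_def)
  qed
  then show ?thesis by (rule that[OF _ const \<psi>])
qed

end

text \<open>
  The Jacobson property of \<open>A\<close> modulo \<open>P\<close>, relative to points over a ground ring \<open>B\<close> on
  which their values are prescribed by \<open>\<kappa>\<close>.
\<close>

definition separated_by_points :: "'r::comm_ring_1 set \<Rightarrow> 'r set \<Rightarrow> 'r set \<Rightarrow> ('r \<Rightarrow> 'l::field) \<Rightarrow> bool"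
  where "separated_by_points A P B \<kappa> \<longleftrightarrow>
    (\<forall>f \<in> A - P. \<exists>\<phi>. point_on_subring A P \<phi> \<and> (\<forall>y \<in> B. \<phi> y = \<kappa> y) \<and> \<phi> f \<noteq> 0)"

lemma infinite_alg_closed: "infinite (UNIV :: 'l::alg_closed_field set)"
proof
  assume fin: "finite (UNIV :: 'l set)"
  define p :: "'l poly" where "p = (\<Prod>a\<in>UNIV. [:- a, 1:]) + 1"
  have ev: "poly p c = 1" for c
    using fin by (auto simp: p_def poly_prod)
  have "degree (\<Prod>a\<in>(UNIV::'l set). [:- a, 1:]) = card (UNIV :: 'l set)"
    by (subst degree_prod_eq_sum_degree) auto
  moreover have "card (UNIV :: 'l set) > 0" using fin by (simp add: card_gt_0_iff)
  ultimately have "degree p > 0"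
    unfolding p_def by (subst degree_add_eq_left) auto
  then obtain c where "poly p c = 0" using alg_closed_imp_poly_has_root by blast
  then show False using ev by simp
qed

context prime_on_subring begin

text \<open>
  The inductive step of the Nullstellensatz. If \<open>x\<close> is transcendental over \<open>A\<close> modulo \<open>P\<close>, a point
  of \<open>A\<close> at which some coefficient of \<open>F\<close> survives extends with almost any value for \<open>x\<close>.
  Otherwise let \<open>G\<close> be a polynomial of minimal degree, nonzero modulo \<open>P\<close>, that vanishes at \<open>x\<close>
  modulo \<open>P\<close>. Pseudo-division by \<open>G\<close> shows that every root \<open>c\<close> of \<open>G\<close> above a point that does
  not kill the leading coefficient of \<open>G\<close> gives a point of the extension. To keep \<open>f\<close> nonzero,
  one uses that \<open>f\<close> is algebraic, hence divides some \<open>s \<in> A - P\<close> modulo \<open>P\<close>, and starts from a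
  point at which \<open>s\<close> is nonzero as well.
\<close>

theorem separated_adjoin:
  fixes \<kappa> :: "'r \<Rightarrow> 'l::alg_closed_field"
  assumes sep: "separated_by_points A P B \<kappa>" and B: "B \<subseteq> A"
  shows "separated_by_points (adjoin A x) P B \<kappa>"
  unfolding separated_by_points_def
proof
  fix f assume f: "f \<in> adjoin A x - P"
  then obtain F where F: "F \<in> polys_over A" "f = poly F x" by (auto simp: adjoin_def)
  have "\<exists>\<phi> c. point_on_subring A P \<phi> \<and> (\<forall>y \<in> B. \<phi> y = \<kappa> y) \<and> point_on_subring.ev \<phi> c F \<noteq> 0 \<and>
    (\<forall>G \<in> polys_over A. poly G x \<in> P \<longrightarrow> point_on_subring.ev \<phi> c G = 0)"
  proof (cases "\<forall>G \<in> polys_over A. poly G x \<in> P \<longrightarrow> (\<forall>i. coeff G i \<in> P)")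
    case True
    obtain i where i: "coeff F i \<notin> P" using f F poly_in_P by blast
    then obtain \<phi> :: "'r \<Rightarrow> 'l" where \<phi>: "point_on_subring A P \<phi>" "\<forall>y \<in> B. \<phi> y = \<kappa> y" "\<phi> (coeff F i) \<noteq> 0"
      using sep F unfolding separated_by_points_def polys_over_def by blast
    interpret point_on_subring A P \<phi> by fact
    have "coeff (map_poly \<phi> F) i \<noteq> 0" using \<phi> by (simp add: coeff_map_poly hom_zero)
    then have "map_poly \<phi> F \<noteq> 0" by auto
    then have "finite {c. poly (map_poly \<phi> F) c = 0}" by (rule poly_roots_finite)
    \<comment> \<open>an algebraically closed field is infinite\<close>
    then obtain c where "poly (map_poly \<phi> F) c \<noteq> 0"
      using infinite_alg_closed[where 'l = 'l] by (metis (mono_tags) UNIV_I finite_subset mem_Collect_eq subsetI)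
    then have "ev c F \<noteq> 0" by (simp add: ev_def)
    moreover have "\<forall>G \<in> polys_over A. poly G x \<in> P \<longrightarrow> ev c G = 0"
      using True ev_P by blast
    ultimately show ?thesis using \<phi> by blast
  next
    case False
    then obtain G0 i where G0: "G0 \<in> polys_over A" "poly G0 x \<in> P" "coeff G0 i \<notin> P" by blast
    have strip: "poly (H - monom (lead_coeff H) (degree H)) x - z \<in> P"
      if "poly H x - z \<in> P" "lead_coeff H \<in> P" for H z
      using diff_P[OF that(1) mult_P'[OF that(2), of "x ^ degree H"]]
      by (simp add: poly_monom algebra_simps)
    have stripA: "H - monom (lead_coeff H) (degree H) \<in> polys_over A" if "H \<in> polys_over A" for H
      using that by (intro polys_diff polys_monom) (auto simp: polys_over_def)
    define S where "S = {H \<in> polys_over A. poly H x \<in> P}"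
    have closedS: "H - monom (lead_coeff H) (degree H) \<in> S" if "H \<in> S" "lead_coeff H \<in> P" for H
      using that strip[of H 0] stripA by (simp add: S_def)
    have "G0 \<in> S" using G0 by (simp add: S_def)
    then obtain G where GS: "G \<in> S" and a: "lead_coeff G \<notin> P"
      and minS: "\<And>G' j. G' \<in> S \<Longrightarrow> degree G' < degree G \<Longrightarrow> coeff G' j \<in> P"
      using minimal_degree_outside[OF closedS _ G0(3)] by metis
    have G: "G \<in> polys_over A" "poly G x \<in> P" using GS by (auto simp: S_def)
    have minG: "coeff G' j \<in> P"
      if "G' \<in> polys_over A" "poly G' x \<in> P" "degree G' < degree G" for G' j
      using minS[of G' j] that by (simp add: S_def)
    let ?a = "lead_coeff G"
    have degG: "degree G > 0"
    proof (rule ccontr)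
      assume "\<not> degree G > 0"
      then have "poly G x = ?a" by (auto elim: degree_eq_zeroE)
      then show False using G a by simp
    qed
    \<comment> \<open>\<open>M\<close> represents the ideal generated by \<open>f\<close> modulo \<open>P\<close>; an element of degree 0 in it is the
      desired multiple of \<open>f\<close> in \<open>A\<close>\<close>
    define M where "M = {H \<in> polys_over A. \<exists>U \<in> polys_over A. poly H x - poly U x * f \<in> P}"
    have "G \<in> M" unfolding M_def using G polys_0 by (auto intro!: bexI[of _ 0])
    have closedM: "H - monom (lead_coeff H) (degree H) \<in> M" if "H \<in> M" "lead_coeff H \<in> P" for H
      using that strip stripA unfolding M_def by blast
    obtain m where m: "m \<in> M" and b: "lead_coeff m \<notin> P"
      and minm: "\<And>m' j. m' \<in> M \<Longrightarrow> degree m' < degree m \<Longrightarrow> coeff m' j \<in> P"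
      using minimal_degree_outside[OF closedM \<open>G \<in> M\<close> a] by metis
    let ?b = "lead_coeff m"
    obtain U where mA: "m \<in> polys_over A" and U: "U \<in> polys_over A" "poly m x - poly U x * f \<in> P"
      using m by (auto simp: M_def)
    have m0: "m \<noteq> 0" using b zero_P by auto
    have bA: "?b \<in> A" and aA: "?a \<in> A" using mA G by (auto simp: polys_over_def)
    have bk: "?b ^ k \<notin> P" for k using power_P b by blast
    \<comment> \<open>remainders of elements of \<open>M\<close> modulo \<open>m\<close> have all coefficients in \<open>P\<close>\<close>
    have rem: "coeff r j \<in> P"
      if H: "H \<in> M" "smult (?b ^ k) H = q * m + r" "q \<in> polys_over A" "r \<in> polys_over A"
        "r = 0 \<or> degree r < degree m" for H k q r j
    proof -
      obtain V where V: "V \<in> polys_over A" "poly H x - poly V x * f \<in> P"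
        using H by (auto simp: M_def)
      have "poly r x = ?b ^ k * poly H x - poly q x * poly m x"
        using H(2) by (metis add_diff_cancel_left' poly_add poly_mult poly_smult)
      then have "poly r x - poly (smult (?b ^ k) V - q * U) x * f =
          ?b ^ k * (poly H x - poly V x * f) - poly q x * (poly m x - poly U x * f)"
        by (simp add: algebra_simps)
      also have "\<dots> \<in> P" by (intro diff_P mult_P V U)
      finally have "r \<in> M" unfolding M_def using H V U bA
        by (auto intro!: bexI[of _ "smult (?b ^ k) V - q * U"] polys_diff polys_mult polys_smult power_A)
      then show ?thesis using H(5) minm zero_P by (cases "r = 0") auto
    qed
    have "F \<in> M" unfolding M_def using F polys_const[OF one_A] zero_P by (auto intro!: bexI[of _ "[:1:]"])
    have "poly m x \<notin> P"
    proof
      assume "poly m x \<in> P"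
      obtain k q r where "q \<in> polys_over A" "r \<in> polys_over A" "smult (?b ^ k) F = q * m + r"
        "r = 0 \<or> degree r < degree m" using pseudo_division[OF mA F(1) m0] by metis
      with rem[OF \<open>F \<in> M\<close>] have "poly (q * m + r) x \<in> P"
        using \<open>poly m x \<in> P\<close> by (auto intro!: add_P mult_P poly_in_P)
      then have "?b ^ k * f \<in> P" using \<open>smult (?b ^ k) F = _\<close> F by (metis poly_smult)
      then show False using prime_P bk f by blast
    qed
    \<comment> \<open>dividing \<open>G\<close> by \<open>m\<close> leaves a quotient that vanishes at \<open>x\<close>, so minimality of \<open>G\<close> leaves no
      room for a positive degree of \<open>m\<close>\<close>
    have "degree m = 0"
    proof -
      obtain k q r where *: "q \<in> polys_over A" "r \<in> polys_over A" "smult (?b ^ k) G = q * m + r"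
        "r = 0 \<or> degree r < degree m" "degree q \<le> degree G - degree m"
        using pseudo_division[OF mA G(1) m0] by metis
      have r: "coeff r j \<in> P" for j using rem[OF \<open>G \<in> M\<close> *(3,1,2,4)] .
      have "poly q x * poly m x = ?b ^ k * poly G x - poly r x"
        using *(3) by (metis add_diff_cancel_right' poly_add poly_mult poly_smult)
      also have "\<dots> \<in> P" using diff_P[OF mult_P[OF G(2)] poly_in_P[OF r]] .
      finally have q: "poly q x \<in> P" using prime_P \<open>poly m x \<notin> P\<close> by blast
      have "\<exists>j. coeff q j \<notin> P"
      proof (rule ccontr)
        assume "\<nexists>j. coeff q j \<notin> P"
        then have "coeff (q * m + r) (degree G) \<in> P"
          using r by (auto simp: coeff_mult intro!: add_P sum_P mult_P')
        then have "?b ^ k * ?a \<in> P" using *(3) by (metis coeff_smult)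
        then show False using prime_P bk a by blast
      qed
      then have "degree G \<le> degree q" using minG[OF *(1) q] by force
      then show ?thesis using *(5) degG by linarith
    qed
    then obtain s where s: "m = [:s:]" by (meson degree_eq_zeroE)
    then have sb: "s = ?b" by simp
    have "?a * s \<in> A - P" using aA bA a b sb mult_A prime_P by blast
    then obtain \<phi> :: "'r \<Rightarrow> 'l" where \<phi>: "point_on_subring A P \<phi>" "\<forall>y \<in> B. \<phi> y = \<kappa> y" "\<phi> (?a * s) \<noteq> 0"
      using sep unfolding separated_by_points_def by blast
    interpret point_on_subring A P \<phi> by fact
    have "\<phi> ?a \<noteq> 0" "\<phi> s \<noteq> 0" using \<phi>(3) hom_mult aA bA sb by auto
    have "degree (map_poly \<phi> G) = degree G"
      using \<open>\<phi> ?a \<noteq> 0\<close> by (rule map_poly_degree_eq)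
    then obtain c where "poly (map_poly \<phi> G) c = 0"
      using alg_closed_imp_poly_has_root[of "map_poly \<phi> G"] degG by auto
    then have c: "ev c G = 0" by (simp add: ev_def)
    have kill: "ev c H = 0" if H: "H \<in> polys_over A" "poly H x \<in> P" for H
    proof -
      have "G \<noteq> 0" using a zero_P by auto
      then obtain k q r where *: "q \<in> polys_over A" "r \<in> polys_over A" "smult (?a ^ k) H = q * G + r"
        "r = 0 \<or> degree r < degree G"
        using pseudo_division[OF G(1) H(1)] by metis
      have "poly r x = ?a ^ k * poly H x - poly q x * poly G x"
        using *(3) by (metis add_diff_cancel_left' poly_add poly_mult poly_smult)
      also have "\<dots> \<in> P" using H G by (intro diff_P mult_P)
      finally have "coeff r j \<in> P" for j using minG[OF *(2)] *(4) zero_P by (cases "r = 0") auto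
      then have "ev c r = 0" using ev_P * by blast
      then have "ev c (smult (?a ^ k) H) = 0"
        using * G c by (simp add: ev_add ev_mult polys_mult)
      then show ?thesis
        using ev_smult[of "?a ^ k" H c] aA power_A H hom_power \<open>\<phi> ?a \<noteq> 0\<close> by simp
    qed
    have "ev c (m - U * F) = 0" using U mA F by (intro kill polys_diff polys_mult) auto
    then have "\<phi> s = ev c U * ev c F" using mA U F s
      by (simp add: ev_diff ev_mult polys_mult ev_const)
    then have "ev c F \<noteq> 0" using \<open>\<phi> s \<noteq> 0\<close> by auto
    then show ?thesis using \<phi> kill by blast
  qed
  then obtain \<phi> :: "'r \<Rightarrow> 'l" and c where \<phi>: "point_on_subring A P \<phi>" "\<forall>y \<in> B. \<phi> y = \<kappa> y"
    "point_on_subring.ev \<phi> c F \<noteq> 0"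
    "\<And>G. G \<in> polys_over A \<Longrightarrow> poly G x \<in> P \<Longrightarrow> point_on_subring.ev \<phi> c G = 0" by blast
  interpret point_on_subring A P \<phi> by fact
  have "\<exists>\<psi>. point_on_subring (adjoin A x) P \<psi> \<and> (\<forall>a \<in> A. \<psi> a = \<phi> a) \<and>
    (\<forall>G \<in> polys_over A. \<psi> (poly G x) = ev c G)"
    by (rule extend_point[of x c]) (use \<phi>(4) in blast)+
  then obtain \<psi> where \<psi>: "point_on_subring (adjoin A x) P \<psi>" "\<forall>a \<in> A. \<psi> a = \<phi> a"
    "\<forall>G \<in> polys_over A. \<psi> (poly G x) = ev c G" by blast
  have "\<forall>y \<in> B. \<psi> y = \<kappa> y" using \<psi>(2) \<phi>(2) B by (metis subsetD)
  moreover have "\<psi> f \<noteq> 0" using bspec[OF \<psi>(3) F(1)] \<phi>(3) F(2) by simp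
  ultimately show "\<exists>\<psi>. point_on_subring (adjoin A x) P \<psi> \<and> (\<forall>y \<in> B. \<psi> y = \<kappa> y) \<and> \<psi> f \<noteq> 0"
    using \<psi>(1) by blast
qed

end

section \<open>Polynomials and their values at points\<close>

lemma pring_simps [simp]:
  "carrier (pring :: 'a::comm_ring_1 ring) = UNIV"
  "x \<otimes>\<^bsub>(pring :: 'a ring)\<^esub> y = x * y"
  "x \<oplus>\<^bsub>(pring :: 'a ring)\<^esub> y = x + y"
  "\<zero>\<^bsub>(pring :: 'a ring)\<^esub> = 0"
  "\<one>\<^bsub>(pring :: 'a ring)\<^esub> = 1"
  by (simp_all add: ring_of_type_algebra_def)

lemma cring_pring: "cring (pring :: 'a::comm_ring_1 ring)"
  by (rule cring_from_type_algebra)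

lemma pring_minus [simp]:
  "\<ominus>\<^bsub>(pring :: 'a::comm_ring_1 ring)\<^esub> x = - x" "x \<ominus>\<^bsub>(pring :: 'a ring)\<^esub> y = x - y"
proof -
  interpret cring "pring :: 'a ring" by (rule cring_pring)
  show *: "\<ominus>\<^bsub>(pring :: 'a ring)\<^esub> x = - x" for x :: 'a
    using minus_equality[of "- x" x] by simp
  show "x \<ominus>\<^bsub>(pring :: 'a ring)\<^esub> y = x - y"
    by (simp add: a_minus_def *)
qed

lemma keys_sum_superset:
  assumes "finite S" "Poly_Mapping.keys f \<subseteq> S" "\<And>u. h u 0 = 0"
  shows "(\<Sum>u\<in>Poly_Mapping.keys f. h u (Poly_Mapping.lookup f u)) = (\<Sum>u\<in>S. h u (Poly_Mapping.lookup f u))"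
  using assms by (intro sum.mono_neutral_left) (auto simp: in_keys_iff)

lemma keys_sum_add:
  fixes h :: "'u \<Rightarrow> 'c::comm_monoid_add \<Rightarrow> 'd::comm_monoid_add"
  assumes "\<And>u. h u 0 = 0" "\<And>u a b. h u (a + b) = h u a + h u b"
  shows "(\<Sum>u\<in>Poly_Mapping.keys (f + g). h u (Poly_Mapping.lookup (f + g) u)) =
    (\<Sum>u\<in>Poly_Mapping.keys f. h u (Poly_Mapping.lookup f u)) +
    (\<Sum>u\<in>Poly_Mapping.keys g. h u (Poly_Mapping.lookup g u))"
proof -
  let ?S = "Poly_Mapping.keys f \<union> Poly_Mapping.keys g"
  have "Poly_Mapping.keys (f + g) \<subseteq> ?S" by (rule keys_add)
  then show ?thesis
    using keys_sum_superset[of ?S "f + g" h] keys_sum_superset[of ?S f h]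
      keys_sum_superset[of ?S g h] assms
    by (simp add: lookup_add sum.distrib)
qed

lemma poly_mapping_induct [case_names single add]:
  fixes f :: "'u \<Rightarrow>\<^sub>0 'c::comm_monoid_add"
  assumes single: "\<And>u c. Q (Poly_Mapping.single u c)"
    and add: "\<And>f g. Q f \<Longrightarrow> Q g \<Longrightarrow> Q (f + g)"
  shows "Q f"
proof -
  have sum: "Q (\<Sum>u\<in>S. Poly_Mapping.single u (Poly_Mapping.lookup f u))" if "finite S" for S
    using that by induction (use single[of _ 0] single add in auto)
  have "f = (\<Sum>u\<in>Poly_Mapping.keys f. Poly_Mapping.single u (Poly_Mapping.lookup f u))"
    by (rule poly_mapping_eqI) (auto simp: lookup_sum lookup_single when_def in_keys_iff)
  then show ?thesis using sum[of "Poly_Mapping.keys f"] by simp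
qed

lemma tdeg_add: "tdeg (u + v) = tdeg u + tdeg v"
  unfolding tdeg_def by (rule keys_sum_add) auto

lemma tdeg_0 [simp]: "tdeg 0 = 0"
  by (simp add: tdeg_def)

lemma tdeg_var [simp]: "tdeg (pterm_var x) = 1"
  by (simp add: tdeg_def pterm_var_def)

lemma tdeg_eq_0_iff [simp]: "tdeg u = 0 \<longleftrightarrow> u = 0"
  by (auto simp: tdeg_def in_keys_iff intro!: poly_mapping_eqI)

lemma term_split:
  assumes "x \<in> Poly_Mapping.keys u"
  obtains v where "u = pterm_var x + v"
proof
  show "u = pterm_var x + (u - pterm_var x)"
    using assms by (intro poly_mapping_eqI)
      (auto simp: lookup_add lookup_minus pterm_var_def lookup_single when_def in_keys_iff)
qed

lemma term_induct [case_names zero var]: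
  assumes zero: "Q 0" and var: "\<And>x u. Q u \<Longrightarrow> Q (pterm_var x + u)"
  shows "Q u"
proof (induction "tdeg u" arbitrary: u rule: less_induct)
  case less
  show ?case
  proof (cases "u = 0")
    case False
    then obtain x where "x \<in> Poly_Mapping.keys u" by fastforce
    then obtain v where v: "u = pterm_var x + v" by (rule term_split)
    then have "Q v" by (intro less) (simp add: tdeg_add)
    then show ?thesis using var v by simp
  qed (use zero in simp)
qed

lemma single_eq_const_mult: "Poly_Mapping.single u c = pconst c * pmonom u"
  by (simp add: pconst_def pmonom_def mult_single)

lemma pmonom_add: "pmonom (u + v) = pmonom u * pmonom v"
  by (simp add: pmonom_def mult_single)

lemma pmonom_0: "pmonom 0 = 1"
  by (simp add: pmonom_def)

lemma pconst_simps:
  "pconst 0 = 0" "pconst 1 = 1" "pconst (a + b) = pconst a + pconst b"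
  "pconst (a - b) = pconst a - pconst b" "pconst (a * b) = pconst a * pconst b"
  by (simp_all add: pconst_def single_add single_diff mult_single)

lemma mpoly_induct [case_names const var add mult]:
  fixes f :: "('v, 'k::comm_ring_1) mpoly"
  assumes const: "\<And>c. Q (pconst c)" and var: "\<And>x. Q (pvar x)"
    and add: "\<And>f g. Q f \<Longrightarrow> Q g \<Longrightarrow> Q (f + g)" and mult: "\<And>f g. Q f \<Longrightarrow> Q g \<Longrightarrow> Q (f * g)"
  shows "Q f"
proof -
  have "Q (pmonom u)" for u
    by (induction u rule: term_induct)
      (use const[of 1] mult var in \<open>auto simp: pmonom_0 pmonom_add pconst_simps pvar_def\<close>)
  then show ?thesis
    by (induction f rule: poly_mapping_induct) (auto simp: single_eq_const_mult intro: const mult add)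
qed

definition term_value :: "('v \<Rightarrow> 'l::comm_ring_1) \<Rightarrow> 'v pterm \<Rightarrow> 'l"
  where "term_value \<gamma> u = (\<Prod>x\<in>Poly_Mapping.keys u. \<gamma> x ^ Poly_Mapping.lookup u x)"

lemma term_value_superset:
  assumes "finite S" "Poly_Mapping.keys u \<subseteq> S"
  shows "term_value \<gamma> u = (\<Prod>x\<in>S. \<gamma> x ^ Poly_Mapping.lookup u x)"
  unfolding term_value_def using assms by (intro prod.mono_neutral_left) (auto simp: in_keys_iff)

lemma term_value_add: "term_value \<gamma> (u + v) = term_value \<gamma> u * term_value \<gamma> v"
proof -
  let ?S = "Poly_Mapping.keys u \<union> Poly_Mapping.keys v"
  have "Poly_Mapping.keys (u + v) \<subseteq> ?S" by (rule keys_add)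
  then show ?thesis
    using term_value_superset[of ?S u \<gamma>] term_value_superset[of ?S v \<gamma>] term_value_superset[of ?S "u + v" \<gamma>]
    by (simp add: lookup_add power_add prod.distrib)
qed

lemma eval_at_eq: "eval_at \<gamma> f = (\<Sum>u\<in>Poly_Mapping.keys f. to_ac (Poly_Mapping.lookup f u) * term_value \<gamma> u)"
  by (simp add: eval_at_def term_value_def)

lemma eval_at_single: "eval_at \<gamma> (Poly_Mapping.single u c) = to_ac c * term_value \<gamma> u"
  by (simp add: eval_at_eq)

lemma eval_at_add: "eval_at \<gamma> (f + g) = eval_at \<gamma> f + eval_at \<gamma> g"
  unfolding eval_at_eq by (rule keys_sum_add) (auto simp: algebra_simps)

lemma eval_at_mult: "eval_at \<gamma> (f * g) = eval_at \<gamma> f * eval_at \<gamma> g"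
proof (induction f rule: poly_mapping_induct)
  case (single u c)
  show ?case
    by (induction g rule: poly_mapping_induct)
      (simp_all add: mult_single eval_at_single term_value_add distrib_left eval_at_add)
qed (simp add: distrib_right eval_at_add)

lemma eval_at_0 [simp]: "eval_at \<gamma> 0 = 0"
  by (simp add: eval_at_def)

lemma eval_at_const [simp]: "eval_at \<gamma> (pconst c) = to_ac c"
  by (simp add: pconst_def eval_at_single term_value_def)

lemma eval_at_1 [simp]: "eval_at \<gamma> 1 = 1"
  using eval_at_const[of \<gamma> 1] by (simp add: pconst_simps)

lemma eval_at_var [simp]: "eval_at \<gamma> (pvar x) = \<gamma> x"
  by (simp add: pvar_def pmonom_def pterm_var_def eval_at_single term_value_def)

lemma eval_at_uminus: "eval_at \<gamma> (- f) = - eval_at \<gamma> f"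
  using eval_at_add[of \<gamma> f "- f"] by (simp add: eq_neg_iff_add_eq_0 add.commute)

lemma eval_at_diff: "eval_at \<gamma> (f - g) = eval_at \<gamma> f - eval_at \<gamma> g"
  using eval_at_add[of \<gamma> f "- g"] by (simp add: eval_at_uminus)

lemma eval_at_sum: "eval_at \<gamma> (sum f S) = (\<Sum>i\<in>S. eval_at \<gamma> (f i))"
  by (induction S rule: infinite_finite_induct) (auto simp: eval_at_add)

lemma eval_at_prod: "eval_at \<gamma> (prod f S) = (\<Prod>i\<in>S. eval_at \<gamma> (f i))"
  by (induction S rule: infinite_finite_induct) (auto simp: eval_at_mult)

lemma prime_on_subring_const:
  fixes P :: "('v, 'k::field) mpoly set"
  assumes "primeideal P pring"
  shows "prime_on_subring (range pconst) P"
proof -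
  interpret primeideal P "pring :: ('v, 'k) mpoly ring" by fact
  show ?thesis
  proof unfold_locales
    show "1 \<in> range (pconst :: 'k \<Rightarrow> ('v, 'k) mpoly)" by (metis pconst_simps(2) rangeI)
    show "1 \<notin> P" using one_imp_carrier I_notcarr by auto
    show "0 \<in> P" using additive_subgroup.zero_closed[OF is_additive_subgroup] by simp
    show "x - y \<in> P" if "x \<in> P" "y \<in> P" for x y
      using additive_subgroup.a_closed[OF is_additive_subgroup that(1)
          additive_subgroup.a_inv_closed[OF is_additive_subgroup that(2)]] by simp
    show "x * y \<in> P" if "y \<in> P" for x y using I_l_closed[OF that, of x] by simp
    show "x \<in> P \<or> y \<in> P" if "x * y \<in> P" for x y using I_prime[of x y] that by simp
  qed (auto simp flip: pconst_simps)
qed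

section \<open>The Nullstellensatz and closures in the spectrum\<close>

text \<open>
  Adjoining the variables one after the other to the ground field makes every polynomial outside
  \<open>P\<close> visible at a point; a point of the whole polynomial ring is evaluation at the images of the
  variables.
\<close>

theorem nullstellensatz:
  fixes P :: "('v::finite, 'k::field) mpoly set"
  assumes P: "primeideal P pring" and f: "f \<notin> P"
  obtains \<gamma> where "P \<subseteq> spec_point \<gamma>" "f \<notin> spec_point \<gamma>"
proof -
  define \<kappa> :: "('v, 'k) mpoly \<Rightarrow> 'k alg_closure" where "\<kappa> p = to_ac (Poly_Mapping.lookup p 0)" for p
  have \<kappa>: "\<kappa> (pconst c) = to_ac c" for c by (simp add: \<kappa>_def pconst_def)
  let ?B = "range (pconst :: 'k \<Rightarrow> ('v, 'k) mpoly)"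
  interpret B: prime_on_subring ?B P by (rule prime_on_subring_const[OF P])
  have const_P: "c = 0" if "pconst c \<in> P" for c
  proof (rule ccontr)
    assume "c \<noteq> 0"
    then have "1 = pconst (inverse c) * (pconst c :: ('v, 'k) mpoly)"
      by (simp flip: pconst_simps)
    then show False using B.mult_P[OF that, of "pconst (inverse c)"] B.one_P by simp
  qed
  have sepB: "separated_by_points ?B P ?B \<kappa>"
    unfolding separated_by_points_def
  proof
    fix g assume g: "g \<in> ?B - P"
    have "point_on_subring ?B P \<kappa>"
      by unfold_locales (use \<kappa> \<kappa>[of 1] const_P in \<open>auto simp flip: pconst_simps\<close>)
    moreover have "\<kappa> g \<noteq> 0" using g \<kappa> B.zero_P by (auto simp: pconst_simps)
    ultimately show "\<exists>\<phi>. point_on_subring ?B P \<phi> \<and> (\<forall>y\<in>?B. \<phi> y = \<kappa> y) \<and> \<phi> g \<noteq> 0" by blast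
  qed
  have "\<exists>A. prime_on_subring A P \<and> ?B \<subseteq> A \<and> pvar ` S \<subseteq> A \<and> separated_by_points A P ?B \<kappa>"
    if "finite S" for S :: "'v set"
    using that
  proof induction
    case empty
    then show ?case using B.prime_on_subring_axioms sepB by blast
  next
    case (insert x S)
    then obtain A where A: "prime_on_subring A P" "?B \<subseteq> A" "pvar ` S \<subseteq> A" "separated_by_points A P ?B \<kappa>"
      by blast
    interpret prime_on_subring A P by fact
    have "?B \<subseteq> adjoin A (pvar x)" "pvar ` insert x S \<subseteq> adjoin A (pvar x)"
      using A adjoin_subset[of "pvar x"] adjoin_self[of "pvar x"] by auto
    then show ?case using subring_adjoin separated_adjoin[OF A(4,2)] by blast
  qed
  then obtain A where A: "prime_on_subring A P" "?B \<subseteq> A" "range pvar \<subseteq> A" "separated_by_points A P ?B \<kappa>"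
    using finite_class.finite_UNIV by blast
  interpret prime_on_subring A P by fact
  have UNIV: "g \<in> A" for g
    by (induction g rule: mpoly_induct) (use A in \<open>auto intro: add_A mult_A\<close>)
  obtain \<phi> :: "('v, 'k) mpoly \<Rightarrow> 'k alg_closure"
    where \<phi>: "point_on_subring A P \<phi>" "\<forall>y\<in>?B. \<phi> y = \<kappa> y" "\<phi> f \<noteq> 0"
    using A(4) f UNIV unfolding separated_by_points_def by blast
  interpret point_on_subring A P \<phi> by fact
  define \<gamma> where "\<gamma> x = \<phi> (pvar x)" for x
  have eq: "\<phi> g = eval_at \<gamma> g" for g
    by (induction g rule: mpoly_induct)
      (use \<phi>(2) UNIV in \<open>auto simp: \<kappa> \<gamma>_def hom_add hom_mult eval_at_add eval_at_mult\<close>)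
  show ?thesis
  proof
    show "P \<subseteq> spec_point \<gamma>" using hom_P UNIV by (auto simp: spec_point_def simp flip: eq)
    show "f \<notin> spec_point \<gamma>" using \<phi>(3) by (simp add: spec_point_def flip: eq)
  qed
qed

lemma spec_point_in_Spec: "spec_point \<gamma> \<in> Spec pring"
proof -
  interpret cring "pring :: ('a, 'b) mpoly ring" by (rule cring_pring)
  have "primeideal (spec_point \<gamma>) pring"
  proof (rule primeidealI)
    show "ideal (spec_point \<gamma>) pring"
    proof (rule idealI)
      show "subgroup (spec_point \<gamma>) (add_monoid pring)"
        by (rule add.subgroupI)
          (auto simp: spec_point_def eval_at_add eval_at_uminus intro: exI[of _ 0])
    qed (auto simp: spec_point_def eval_at_mult ring_axioms)
    show "carrier pring \<noteq> spec_point \<gamma>" by (auto simp: spec_point_def dest: arg_cong[where f = "\<lambda>S. 1 \<in> S"])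
  qed (auto simp: spec_point_def eval_at_mult is_cring)
  then show ?thesis by (simp add: Spec_def)
qed

lemma openin_zariski: "openin (zariski R) U \<longleftrightarrow> (\<exists>S \<subseteq> carrier R. U = Spec R - zero_locus R S)"
  unfolding zariski_def by (simp add: topology_inverse'[OF istopology_zariski])

lemma topspace_zariski: "topspace (zariski (pring :: 'a::comm_ring_1 ring)) = Spec pring"
proof -
  have "zero_locus (pring :: 'a ring) {1} = {}"
  proof -
    have "1 \<notin> p" if "primeideal p (pring :: 'a ring)" for p
    proof -
      interpret primeideal p "pring :: 'a ring" by fact
      show ?thesis using one_imp_carrier I_notcarr by auto
    qed
    then show ?thesis by (auto simp: zero_locus_def Spec_def)
  qed
  then have "openin (zariski (pring :: 'a ring)) (Spec pring)"
    unfolding openin_zariski by (auto intro!: exI[of _ "{1}"])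
  then show ?thesis
    using openin_subset openin_zariski[of "pring :: 'a ring"] by (metis Diff_subset openin_topspace subset_antisym)
qed

lemma zariski_closure_of:
  "zariski (pring :: 'a::comm_ring_1 ring) closure_of W = {p \<in> Spec pring. \<forall>f. f \<notin> p \<longrightarrow> (\<exists>q \<in> W \<inter> Spec pring. f \<notin> q)}"
proof (intro Set.set_eqI iffI)
  fix p assume p: "p \<in> zariski (pring :: 'a ring) closure_of W"
  then have "p \<in> Spec pring" by (simp add: in_closure_of topspace_zariski)
  moreover have "\<exists>q \<in> W \<inter> Spec pring. f \<notin> q" if "f \<notin> p" for f
  proof -
    have "openin (zariski (pring :: 'a ring)) (Spec pring - zero_locus pring {f})"
      by (auto simp: openin_zariski)
    moreover have "p \<in> Spec pring - zero_locus pring {f}"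
      using that \<open>p \<in> Spec pring\<close> by (simp add: zero_locus_def)
    ultimately obtain q where "q \<in> W" "q \<in> Spec pring - zero_locus pring {f}"
      using p unfolding in_closure_of by blast
    then show ?thesis by (auto simp: zero_locus_def)
  qed
  ultimately show "p \<in> {p \<in> Spec pring. \<forall>f. f \<notin> p \<longrightarrow> (\<exists>q \<in> W \<inter> Spec pring. f \<notin> q)}" by blast
next
  fix p assume p: "p \<in> {p \<in> Spec (pring :: 'a ring). \<forall>f. f \<notin> p \<longrightarrow> (\<exists>q \<in> W \<inter> Spec pring. f \<notin> q)}"
  show "p \<in> zariski (pring :: 'a ring) closure_of W"
    unfolding in_closure_of topspace_zariski
  proof (intro conjI allI impI)
    fix T assume T: "p \<in> T \<and> openin (zariski (pring :: 'a ring)) T"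
    then obtain S where S: "T = Spec pring - zero_locus pring S" by (auto simp: openin_zariski)
    then obtain f where "f \<in> S" "f \<notin> p" using T by (auto simp: zero_locus_def)
    then obtain q where "q \<in> W" "q \<in> Spec pring" "f \<notin> q" using p by blast
    then show "\<exists>y. y \<in> W \<and> y \<in> T" using S \<open>f \<in> S\<close> by (auto simp: zero_locus_def)
  qed (use p in blast)
qed

text \<open>
  Closed sets of the spectrum have enough geometric points: this is the Nullstellensatz read for
  all primes containing \<open>S\<close>, not only the maximal ones.
\<close>

theorem closure_of_points:
  fixes S :: "('v::finite, 'k::field) mpoly set"
  shows "zariski pring closure_of (spec_point ` {\<gamma>. \<forall>f \<in> S. eval_at \<gamma> f = 0}) = zero_locus pring S"
proof (intro Set.set_eqI iffI)
  fix p assume "p \<in> zariski pring closure_of (spec_point ` {\<gamma>. \<forall>f \<in> S. eval_at \<gamma> f = 0})"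
  then show "p \<in> zero_locus pring S"
    unfolding zariski_closure_of zero_locus_def spec_point_def by blast
next
  fix p assume p: "p \<in> zero_locus pring S"
  have "\<exists>q \<in> spec_point ` {\<gamma>. \<forall>f \<in> S. eval_at \<gamma> f = 0} \<inter> Spec pring. f \<notin> q" if f: "f \<notin> p" for f
  proof -
    obtain \<gamma> where "p \<subseteq> spec_point \<gamma>" "f \<notin> spec_point \<gamma>"
      using nullstellensatz[OF _ f] p by (auto simp: zero_locus_def Spec_def)
    moreover from this have "\<forall>g \<in> S. eval_at \<gamma> g = 0"
      using p by (auto simp: zero_locus_def spec_point_def)
    ultimately show ?thesis using spec_point_in_Spec by blast
  qed
  then show "p \<in> zariski pring closure_of (spec_point ` {\<gamma>. \<forall>f \<in> S. eval_at \<gamma> f = 0})"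
    using p unfolding zariski_closure_of by (auto simp: zero_locus_def)
qed

lemma zero_locus_Idl: "zero_locus (pring :: 'a::comm_ring_1 ring) (Idl\<^bsub>pring\<^esub> S) = zero_locus pring S"
proof -
  interpret cring "pring :: 'a ring" by (rule cring_pring)
  have "(Idl\<^bsub>pring\<^esub> S \<subseteq> p) = (S \<subseteq> p)" if "primeideal p (pring :: 'a ring)" for p
  proof -
    interpret primeideal p "pring :: 'a ring" by fact
    show ?thesis using Idl_subset_ideal[of p S] is_ideal by simp
  qed
  then show ?thesis by (auto simp: zero_locus_def Spec_def)
qed

section \<open>Minors and the dimension of a span\<close>

no_notation fps_nth (infixl "$" 75)

lemma independent_family_iff:
  fixes v :: "'i \<Rightarrow> 'l::field ^ 'm"
  assumes fin: "finite S"
  shows "inj_on v S \<and> vec.independent (v ` S) \<longleftrightarrow>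
    (\<forall>a. (\<Sum>i\<in>S. a i *s v i) = 0 \<longrightarrow> (\<forall>i\<in>S. a i = 0))"
proof
  assume *: "inj_on v S \<and> vec.independent (v ` S)"
  show "\<forall>a. (\<Sum>i\<in>S. a i *s v i) = 0 \<longrightarrow> (\<forall>i\<in>S. a i = 0)"
  proof (intro allI impI ballI)
    fix a i assume a: "(\<Sum>i\<in>S. a i *s v i) = 0" and i: "i \<in> S"
    have "(\<Sum>x\<in>v ` S. a (the_inv_into S v x) *s x) = (\<Sum>i\<in>S. a i *s v i)"
      using * by (subst sum.reindex) (auto simp: the_inv_into_f_f)
    then have "a (the_inv_into S v (v i)) = 0"
      using vec.independentD[of "v ` S" "v ` S" "\<lambda>x. a (the_inv_into S v x)" "v i"] * a i fin by auto
    then show "a i = 0" using * i by (simp add: the_inv_into_f_f)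
  qed
next
  assume *: "\<forall>a. (\<Sum>i\<in>S. a i *s v i) = 0 \<longrightarrow> (\<forall>i\<in>S. a i = 0)"
  have inj: "inj_on v S"
  proof (rule inj_onI, rule ccontr)
    fix i j assume ij: "i \<in> S" "j \<in> S" "v i = v j" "i \<noteq> j"
    define a where "a k = (if k = i then 1 else if k = j then - 1 else (0 :: 'l))" for k
    have "(\<Sum>k\<in>S. a k *s v k) = (\<Sum>k\<in>{i, j}. a k *s v k)"
      using ij fin by (intro sum.mono_neutral_right) (auto simp: a_def)
    also have "\<dots> = 0" using ij by (simp add: a_def vector_sneg_minus1[symmetric])
    finally have "a i = 0" using * ij by blast
    then show False by (simp add: a_def)
  qed
  moreover have "vec.independent (v ` S)"
  proof (rule vec.independent_if_scalars_zero)
    fix f x assume "(\<Sum>x\<in>v ` S. f x *s x) = 0" and x: "x \<in> v ` S"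
    then have "(\<Sum>i\<in>S. f (v i) *s v i) = 0" using inj by (simp add: sum.reindex)
    then have "\<forall>i\<in>S. f (v i) = 0" using *[rule_format, of "\<lambda>i. f (v i)"] by blast
    then show "f x = 0" using x by blast
  qed (use fin in simp)
  ultimately show "inj_on v S \<and> vec.independent (v ` S)" ..
qed

lemma independent_columns_iff_det:
  fixes v :: "'m \<Rightarrow> 'l::field ^ 'm::finite"
  shows "inj v \<and> vec.independent (range v) \<longleftrightarrow> Determinants.det (\<chi> i j. v j $ i) \<noteq> 0"
proof -
  have "column j (\<chi> i j. v j $ i) = v j" for j by (simp add: column_def)
  then show ?thesis
    using invertible_det_nz[of "\<chi> i j. v j $ i"] invertible_left_inverse[of "\<chi> i j. v j $ i"]
      matrix_left_invertible_independent_columns[of "\<chi> i j. v j $ i"] independent_family_iff[of UNIV v]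
    by auto
qed

text \<open>
  Induction on the number of vectors. Given a nonzero minor of the first \<open>k\<close> vectors, adjoin one
  further row and expand along it: the cofactors do not depend on the choice of that row, so if
  every choice gave a zero minor, the cofactors would be the coefficients of a linear relation, and
  the last cofactor is the given nonzero minor.
\<close>

lemma independent_imp_minor:
  fixes v :: "nat \<Rightarrow> 'l::field ^ 'm"
  assumes "\<forall>a. (\<Sum>y<k. a y *s v y) = 0 \<longrightarrow> (\<forall>y<k. a y = 0)"
  shows "\<exists>p. inj_on p {..<k} \<and> Determinant.det (Matrix.mat k k (\<lambda>(x, y). v y $ p x)) \<noteq> 0"
  using assms
proof (induction k)
  case 0
  then show ?case by (intro exI[of _ undefined]) simp
next
  case (Suc k)
  have "\<forall>a. (\<Sum>y<k. a y *s v y) = 0 \<longrightarrow> (\<forall>y<k. a y = 0)"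
  proof (intro allI impI)
    fix a y assume "(\<Sum>y<k. a y *s v y) = 0" and "y < k"
    then have "(\<Sum>y<Suc k. (a(k := 0)) y *s v y) = 0" by simp
    then have "\<forall>y<Suc k. (a(k := 0)) y = 0" using Suc.prems by blast
    then show "a y = 0" using \<open>y < k\<close> by (metis fun_upd_other less_SucI nat_neq_iff)
  qed
  then obtain p where p: "inj_on p {..<k}"
    "Determinant.det (Matrix.mat k k (\<lambda>(x, y). v y $ p x)) \<noteq> 0" using Suc.IH by blast
  define M where "M r = Matrix.mat (Suc k) (Suc k) (\<lambda>(x, y). v y $ (p(k := r)) x)" for r
  have Mc: "M r \<in> carrier_mat (Suc k) (Suc k)" for r by (simp add: M_def)
  obtain r where r: "Determinant.det (M r) \<noteq> 0"
  proof (rule ccontr)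
    assume "\<not> thesis"
    then have zero: "Determinant.det (M r) = 0" for r using that by blast
    define a where "a j = cofactor (M undefined) k j" for j
    have entry: "M r $$ (k, j) = v j $ r" if "j < Suc k" for r j
      using that by (simp add: M_def)
    have cof: "cofactor (M r) k j = a j" for r j
    proof -
      have "mat_delete (M r) k j = mat_delete (M undefined) k j"
        by (rule eq_matI) (auto simp: mat_delete_def M_def)
      then show ?thesis by (simp add: a_def cofactor_def)
    qed
    have comp: "(\<Sum>y<Suc k. a y *s v y) $ r = 0" for r
    proof -
      have "0 = (\<Sum>j<Suc k. M r $$ (k, j) * cofactor (M r) k j)"
        using laplace_expansion_row[OF Mc, of k r] zero by simp
      also have "\<dots> = (\<Sum>j<Suc k. a j * v j $ r)"
        by (rule sum.cong) (auto simp: cof entry mult.commute)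
      finally show ?thesis by (simp add: sum_component)
    qed
    have "(\<Sum>y<Suc k. a y *s v y) = 0"
      by (rule iffD2[OF Finite_Cartesian_Product.vec_eq_iff], rule allI, subst zero_index, rule comp)
    then have "a k = 0" using Suc.prems by blast
    moreover have "mat_delete (M undefined) k k = Matrix.mat k k (\<lambda>(x, y). v y $ p x)"
      by (rule eq_matI) (auto simp: mat_delete_def M_def)
    then have "a k = Determinant.det (Matrix.mat k k (\<lambda>(x, y). v y $ p x))"
      by (simp add: a_def cofactor_def)
    ultimately show False using p by simp
  qed
  have "r \<notin> p ` {..<k}"
  proof
    assume "r \<in> p ` {..<k}"
    then obtain x where x: "x < k" "r = p x" by auto
    have "Matrix.row (M r) x = Matrix.row (M r) k"
      using x by (intro eq_vecI) (auto simp: M_def)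
    then have "Determinant.det (M r) = 0"
      using x by (intro Determinant.det_identical_rows[OF Mc, of x k]) auto
    then show False using r by simp
  qed
  then have "inj_on (p(k := r)) {..<Suc k}"
    using p by (auto simp: lessThan_Suc inj_on_fun_updI inj_on_def)
  then show ?case using r unfolding M_def by blast
qed

lemma minor_imp_independent:
  fixes v :: "nat \<Rightarrow> 'l::field ^ 'm"
  assumes det: "Determinant.det (Matrix.mat k k (\<lambda>(x, y). v y $ p x)) \<noteq> 0"
  shows "\<forall>a. (\<Sum>y<k. a y *s v y) = 0 \<longrightarrow> (\<forall>y<k. a y = 0)"
proof (intro allI impI)
  fix a y assume a: "(\<Sum>y<k. a y *s v y) = 0" and y: "y < k"
  let ?M = "Matrix.mat k k (\<lambda>(x, y). v y $ p x)"
  have "?M *\<^sub>v Matrix.vec k a = 0\<^sub>v k"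
  proof (rule eq_vecI)
    fix x assume x: "x < dim_vec (0\<^sub>v k :: 'l Matrix.vec)"
    have "(\<Sum>y<k. a y * v y $ p x) = (\<Sum>y<k. a y *s v y) $ p x" by (simp add: sum_component)
    then have "(\<Sum>y<k. a y * v y $ p x) = 0" using a by simp
    then show "vec_index (?M *\<^sub>v Matrix.vec k a) x = vec_index (0\<^sub>v k) x"
      using x by (simp add: scalar_prod_def mult.commute atLeast0LessThan)
  qed simp
  then have "Matrix.vec k a = 0\<^sub>v k"
    using det_0_iff_vec_prod_zero[of ?M k] det by (metis mat_carrier vec_carrier)
  then have "vec_index (Matrix.vec k a) y = 0" using y by simp
  then show "a y = 0" using y by simp
qed

text \<open>
  The index set \<open>U\<close> may be infinite, so this is not the rank of a matrix of fixed format.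
\<close>

theorem le_dim_iff_minor:
  fixes w :: "'c \<Rightarrow> 'l::field ^ 'm"
  shows "k \<le> vec.dim (w ` U) \<longleftrightarrow>
    (\<exists>p q. inj_on p {..<k} \<and> inj_on q {..<k} \<and> q ` {..<k} \<subseteq> U \<and>
      Determinant.det (Matrix.mat k k (\<lambda>(x, y). w (q y) $ p x)) \<noteq> 0)"
proof
  assume k: "k \<le> vec.dim (w ` U)"
  obtain B where B: "B \<subseteq> w ` U" "vec.independent B" "card B = vec.dim (w ` U)"
    using vec.basis_exists[of "w ` U"] by metis
  have finB: "finite B" using B vec.finiteI_independent by blast
  then obtain f where f: "bij_betw f {..<card B} B"
    by (metis atLeast0LessThan ex_bij_betw_nat_finite)
  define v where "v y = f y" for y :: nat
  have v: "inj_on v {..<k}" "v ` {..<k} \<subseteq> B"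
    using f k B(3) by (auto simp: v_def bij_betw_def inj_on_def)
  have "\<forall>y\<in>{..<k}. \<exists>u\<in>U. w u = v y" using v(2) B(1) by fastforce
  then obtain q where q: "\<And>y. y < k \<Longrightarrow> q y \<in> U \<and> w (q y) = v y" by (metis lessThan_iff)
  have "vec.independent (v ` {..<k})" using vec.independent_mono B(2) v(2) by blast
  then have "\<forall>a. (\<Sum>y<k. a y *s v y) = 0 \<longrightarrow> (\<forall>y<k. a y = 0)"
    using v(1) independent_family_iff[of "{..<k}" v] by auto
  then obtain p where p: "inj_on p {..<k}" "Determinant.det (Matrix.mat k k (\<lambda>(x, y). v y $ p x)) \<noteq> 0"
    using independent_imp_minor[where k = k and v = v] by blast
  have "Matrix.mat k k (\<lambda>(x, y). w (q y) $ p x) = Matrix.mat k k (\<lambda>(x, y). v y $ p x)"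
    by (rule eq_matI) (auto simp: q)
  moreover have "inj_on q {..<k}" using v(1) q unfolding inj_on_def by (metis lessThan_iff)
  ultimately show "\<exists>p q. inj_on p {..<k} \<and> inj_on q {..<k} \<and> q ` {..<k} \<subseteq> U \<and>
      Determinant.det (Matrix.mat k k (\<lambda>(x, y). w (q y) $ p x)) \<noteq> 0"
    using p q by (intro exI[of _ p] exI[of _ q]) auto
next
  assume "\<exists>p q. inj_on p {..<k} \<and> inj_on q {..<k} \<and> q ` {..<k} \<subseteq> U \<and>
      Determinant.det (Matrix.mat k k (\<lambda>(x, y). w (q y) $ p x)) \<noteq> 0"
  then obtain p q where q: "q ` {..<k} \<subseteq> U"
    "Determinant.det (Matrix.mat k k (\<lambda>(x, y). w (q y) $ p x)) \<noteq> 0" by blast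
  have "inj_on (\<lambda>y. w (q y)) {..<k} \<and> vec.independent ((\<lambda>y. w (q y)) ` {..<k})"
    using minor_imp_independent[OF q(2)] independent_family_iff[of "{..<k}" "\<lambda>y. w (q y)"] by auto
  moreover have "(\<lambda>y. w (q y)) ` {..<k} \<subseteq> w ` U" using q(1) by auto
  ultimately have "card ((\<lambda>y. w (q y)) ` {..<k}) \<le> vec.dim (w ` U)" and "inj_on (\<lambda>y. w (q y)) {..<k}"
    using vec.independent_card_le_dim by blast+
  then show "k \<le> vec.dim (w ` U)" by (simp add: card_image)
qed

section \<open>The residue class ring at a point of the border basis scheme\<close>

definition mult_mat_at ::
  "('m::finite \<Rightarrow> 'n pterm) \<Rightarrow> ('b \<Rightarrow> 'n pterm) \<Rightarrow> ('m \<times> 'b \<Rightarrow> 'l::field) \<Rightarrow> 'n \<Rightarrow> 'l ^ 'm ^ 'm"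
  where "mult_mat_at t b \<gamma> r = (\<chi> i j.
    let u = pterm_var r + t j in
      if u \<in> range t then (if t i = u then 1 else 0) else \<gamma> (i, inv_into UNIV b u))"

lemma column_mult: "column j (M ** N) = M *v column j N"
  by (simp add: column_def matrix_matrix_mult_def matrix_vector_mult_def)

lemma mult_axis: "M *v axis j 1 = column j M" for M :: "'l::comm_ring_1 ^ 'm ^ 'm"
  by (simp add: column_def matrix_vector_mult_def axis_def if_distrib cong: if_cong)

locale border_basis_point =
  fixes t :: "'m::{finite,linorder} \<Rightarrow> 'n::{finite,linorder} pterm"
    and b :: "'b::finite \<Rightarrow> 'n pterm"
    and \<gamma> :: "'m \<times> 'b \<Rightarrow> 'l::field"
  assumes enum: "order_ideal_enum t"
    and inj_b: "inj b" and range_b: "range b = border (range t)"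
    and commute: "\<And>r s. mult_mat_at t b \<gamma> r ** mult_mat_at t b \<gamma> s =
      mult_mat_at t b \<gamma> s ** mult_mat_at t b \<gamma> r"
begin

abbreviation A where "A \<equiv> mult_mat_at t b \<gamma>"

text \<open>
  Commuting multiplication matrices make the space of column vectors a module over the polynomial
  ring, generated by the first basis vector. The vector below is the term \<open>u\<close> applied to that
  generator.
\<close>

definition "tvec u = column (Min UNIV) (term_mat A u)"

lemma inj_t: "inj t"
  using enum by (simp add: order_ideal_enum_def)

lemma divisor_in_range: "s + v \<in> range t \<Longrightarrow> s \<in> range t"
  using enum unfolding order_ideal_enum_def order_ideal_def by metis

lemma t_Min: "t (Min UNIV) = 0"
proof -
  obtain i where "i \<in> (UNIV :: 'm set)" by blast
  then have "0 + t i \<in> range t" by simp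
  then obtain j where j: "t j = 0" using divisor_in_range by (metis imageE)
  have "mono (\<lambda>i. tdeg (t i))" using enum by (simp add: order_ideal_enum_def)
  then have "tdeg (t (Min UNIV)) \<le> tdeg (t j)" by (rule monoD) simp
  then show ?thesis using j by simp
qed

lemma term_mat_0: "term_mat A 0 = Finite_Cartesian_Product.mat 1"
proof -
  have "foldr (\<lambda>x M. mat_pow (A x) (Poly_Mapping.lookup 0 x) ** M) xs (Finite_Cartesian_Product.mat 1) =
    Finite_Cartesian_Product.mat 1" for xs
    by (induction xs) (auto simp: mat_pow_def)
  then show ?thesis by (simp add: term_mat_def)
qed

lemma commute_mat_pow: "A y ** mat_pow (A x) k = mat_pow (A x) k ** A y"
proof (induction k)
  case (Suc k)
  have P: "mat_pow (A x) (Suc k) = A x ** mat_pow (A x) k" by (simp add: mat_pow_def)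
  have "A y ** mat_pow (A x) (Suc k) = A x ** (A y ** mat_pow (A x) k)"
    using commute[of x y] by (simp add: P matrix_mul_assoc)
  then show ?case by (simp only: P Suc) (simp only: matrix_mul_assoc)
qed (simp add: mat_pow_def)

lemma term_mat_var: "term_mat A (pterm_var y + u) = A y ** term_mat A u"
proof -
  let ?F = "\<lambda>u xs. foldr (\<lambda>x M. mat_pow (A x) (Poly_Mapping.lookup u x) ** M) xs (Finite_Cartesian_Product.mat 1)"
  have "?F (pterm_var y + u) xs = (if y \<in> set xs then A y ** ?F u xs else ?F u xs)" if "distinct xs" for xs
    using that
  proof (induction xs)
    case (Cons x xs)
    show ?case
    proof (cases "x = y")
      case True
      then show ?thesis
        using Cons by (auto simp: lookup_add pterm_var_def mat_pow_def matrix_mul_assoc)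
    next
      case False
      then have lk: "Poly_Mapping.lookup (pterm_var y + u) x = Poly_Mapping.lookup u x"
        by (simp add: lookup_add pterm_var_def lookup_single)
      have "mat_pow (A x) k ** (A y ** M) = A y ** (mat_pow (A x) k ** M)" for k M
        by (simp add: matrix_mul_assoc commute_mat_pow)
      then show ?thesis using Cons False lk by auto
    qed
  qed simp
  from this[of "sorted_list_of_set UNIV"] show ?thesis by (simp add: term_mat_def)
qed

lemma tvec_0: "tvec 0 = axis (Min UNIV) 1"
  by (simp add: tvec_def term_mat_0 column_def Finite_Cartesian_Product.mat_def axis_def)

lemma tvec_var: "tvec (pterm_var x + u) = A x *v tvec u"
  by (simp add: tvec_def term_mat_var column_mult)

text \<open>
  The columns belonging to an order ideal are unit vectors since each term of an order ideal is
  reached from 1 without leaving the order ideal.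
\<close>

lemma tvec_t: "tvec (t i) = axis i 1"
proof -
  have "\<forall>i. u = t i \<longrightarrow> tvec u = axis i 1" for u
  proof (induction u rule: term_induct)
    case zero
    then show ?case using t_Min inj_t by (metis injD tvec_0)
  next
    case (var x u)
    show ?case
    proof (intro allI impI)
      fix i assume i: "pterm_var x + u = t i"
      then have "u + pterm_var x \<in> range t" by (metis add.commute rangeI)
      then obtain j where j: "u = t j" using divisor_in_range by blast
      then have "tvec (pterm_var x + u) = column j (A x)" using var by (simp add: tvec_var mult_axis)
      also have "\<dots> = axis i 1"
        using i j inj_t by (auto simp: column_def mult_mat_at_def axis_def Let_def inj_eq)
      finally show "tvec (pterm_var x + u) = axis i 1" .
    qed
  qed
  then show ?thesis by blast
qed

lemma border_split:
  obtains x m where "b j = pterm_var x + t m"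
proof -
  have "b j \<in> border (range t)" using range_b by blast
  then show ?thesis using that by (auto simp: border_def)
qed

lemma b_notin: "b j \<notin> range t"
proof -
  have "b j \<in> border (range t)" using range_b by blast
  then show ?thesis by (simp add: border_def)
qed

lemma tvec_b: "tvec (b j) = (\<chi> i. \<gamma> (i, j))"
proof -
  obtain x m where xm: "b j = pterm_var x + t m" by (rule border_split)
  have "tvec (b j) = column m (A x)" by (simp add: xm tvec_var tvec_t mult_axis)
  also have "\<dots> = (\<chi> i. \<gamma> (i, j))"
    using b_notin[of j] inj_b by (simp add: column_def mult_mat_at_def Let_def flip: xm)
  finally show ?thesis .
qed

lemma var_times_t: "(\<exists>i. pterm_var x + t m = t i) \<or> (\<exists>j. pterm_var x + t m = b j)"
proof (cases "pterm_var x + t m \<in> range t")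
  case False
  then have "pterm_var x + t m \<in> range b" unfolding range_b by (auto simp: border_def)
  then show ?thesis by blast
qed blast

text \<open>
  The linear extension of \<open>tvec\<close>; it will turn out to be the coordinate vector of the residue class
  of \<open>p\<close> with respect to the basis \<open>t\<close>.
\<close>

definition "coords p = (\<Sum>u\<in>Poly_Mapping.keys p. Poly_Mapping.lookup p u *s tvec u)"

lemma coords_add: "coords (p + q) = coords p + coords q"
  unfolding coords_def by (rule keys_sum_add) (auto simp: vector_sadd_rdistrib)

lemma coords_0 [simp]: "coords 0 = 0"
  by (simp add: coords_def)

lemma coords_diff: "coords (p - q) = coords p - coords q"
  using coords_add[of "p - q" q] by simp

lemma coords_sum: "coords (sum f S) = (\<Sum>i\<in>S. coords (f i))"
  by (induction S rule: infinite_finite_induct) (auto simp: coords_add)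

lemma coords_single: "coords (Poly_Mapping.single u c) = c *s tvec u"
  by (simp add: coords_def)

lemma coords_monom: "coords (pmonom u) = tvec u"
  by (simp add: pmonom_def coords_single)

lemma coords_const_mult: "coords (pconst c * p) = c *s coords p"
  by (induction p rule: poly_mapping_induct)
    (simp_all add: pconst_def mult_single coords_single coords_add distrib_left vector_add_ldistrib)

lemma coords_var_mult: "coords (pvar x * p) = A x *v coords p"
proof (induction p rule: poly_mapping_induct)
  case (single u c)
  then show ?case
    by (simp add: pvar_def pmonom_def mult_single coords_single tvec_var vec.scale)
qed (simp add: distrib_left coords_add vec.add)

lemma coords_mult_0: "coords p = 0 \<Longrightarrow> coords (q * p) = 0"
  by (induction q arbitrary: p rule: mpoly_induct)
    (simp_all add: coords_const_mult coords_var_mult distrib_right coords_add mult.assoc)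

definition "normal_form c = (\<Sum>i\<in>UNIV. pconst (c $ i) * pmonom (t i))"

lemma coords_normal_form: "coords (normal_form c) = c"
proof -
  have "coords (normal_form c) = (\<Sum>i\<in>UNIV. c $ i *s axis i 1)"
    by (simp add: normal_form_def coords_sum coords_const_mult coords_monom tvec_t)
  also have "\<dots> = c"
    by (rule basis_expansion)
  finally show ?thesis .
qed

lemma normal_form_simps:
  "normal_form (c + d) = normal_form c + normal_form d"
  "normal_form (a *s c) = pconst a * normal_form c"
  "normal_form (axis i 1) = pmonom (t i)"
proof -
  show "normal_form (c + d) = normal_form c + normal_form d"
    by (simp add: normal_form_def pconst_simps distrib_right sum.distrib)
  show "normal_form (a *s c) = pconst a * normal_form c"
    by (simp add: normal_form_def pconst_simps sum_distrib_left mult.assoc)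
  have "normal_form (axis i 1) = (\<Sum>k\<in>UNIV. if k = i then pmonom (t k) else 0)"
    unfolding normal_form_def by (intro sum.cong) (auto simp: axis_def pconst_simps)
  then show "normal_form (axis i 1) = pmonom (t i)" by simp
qed

abbreviation I where "I \<equiv> point_ideal t b \<gamma>"

lemma ideal_I: "ideal I pring"
proof -
  interpret cring "pring :: ('n, 'l) mpoly ring" by (rule cring_pring)
  show ?thesis unfolding point_ideal_def by (rule genideal_ideal) simp
qed

lemma I_closed:
  "0 \<in> I" "p \<in> I \<Longrightarrow> q \<in> I \<Longrightarrow> p + q \<in> I" "p \<in> I \<Longrightarrow> q * p \<in> I" "p \<in> I \<Longrightarrow> q \<in> I \<Longrightarrow> p - q \<in> I"
proof -
  interpret ideal I "pring :: ('n, 'l) mpoly ring" by (rule ideal_I)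
  show "0 \<in> I" using additive_subgroup.zero_closed[OF is_additive_subgroup] by simp
  show "p + q \<in> I" if "p \<in> I" "q \<in> I" for p q
    using additive_subgroup.a_closed[OF is_additive_subgroup that] by simp
  show "q * p \<in> I" if "p \<in> I" for p q using I_l_closed[OF that, of q] by simp
  show "p - q \<in> I" if "p \<in> I" "q \<in> I"
    using additive_subgroup.a_closed[OF is_additive_subgroup that(1)
          additive_subgroup.a_inv_closed[OF is_additive_subgroup that(2)]] by simp
qed

lemma border_in_I: "pmonom (b j) - normal_form (\<chi> i. \<gamma> (i, j)) \<in> I"
proof -
  interpret cring "pring :: ('n, 'l) mpoly ring" by (rule cring_pring)
  show ?thesis unfolding point_ideal_def normal_form_def by (rule subsetD[OF genideal_self]) auto
qed

text \<open>
  The span of the order ideal together with \<open>I\<close> contains 1 and is closed under multiplication by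
  variables, because a variable times \<open>t m\<close> is again some \<open>t i\<close> or a border term, which a generator
  of \<open>I\<close> rewrites.
\<close>

lemma reduce_mod_I: "\<exists>c. p - normal_form c \<in> I"
proof (induction p rule: poly_mapping_induct)
  case (add p q)
  then obtain c d where "p - normal_form c \<in> I" "q - normal_form d \<in> I" by blast
  from I_closed(2)[OF this] show ?case
    by (intro exI[of _ "c + d"]) (simp add: normal_form_simps algebra_simps)
next
  case (single u a)
  have "\<exists>c. pmonom u - normal_form c \<in> I"
  proof (induction u rule: term_induct)
    case zero
    show ?case
      by (rule exI[of _ "axis (Min UNIV) 1"]) (simp add: normal_form_simps t_Min I_closed)
  next
    case (var x u)
    have t: "\<exists>c. pvar x * pmonom (t m) - normal_form c \<in> I" for m
    proof -
      have eq: "pvar x * pmonom (t m) = (pmonom (pterm_var x + t m) :: ('n, 'l) mpoly)"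
        by (simp add: pvar_def pmonom_add)
      show ?thesis
      proof (cases "\<exists>i. pterm_var x + t m = t i")
        case True
        then obtain i where "pterm_var x + t m = t i" by blast
        then show ?thesis
          unfolding eq by (intro exI[of _ "axis i 1"]) (simp add: normal_form_simps I_closed)
      next
        case False
        then obtain j where "pterm_var x + t m = b j" using var_times_t by blast
        then show ?thesis unfolding eq using border_in_I[of j] by auto
      qed
    qed
    obtain c where c: "pmonom u - normal_form c \<in> I" using var by blast
    obtain d where d: "\<And>m. pvar x * pmonom (t m) - normal_form (d m) \<in> I" using t by metis
    have sum: "(\<Sum>m\<in>S. pconst (c $ m) * (pvar x * pmonom (t m) - normal_form (d m))) \<in> I" if "finite S" for S
      using that by induction (auto simp: I_closed d)
    have nf: "normal_form (\<Sum>m\<in>S. c $ m *s d m) = (\<Sum>m\<in>S. pconst (c $ m) * normal_form (d m))"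
      if "finite S" for S
      using that by induction (simp_all add: normal_form_simps, simp add: normal_form_def pconst_simps)
    have "pmonom (pterm_var x + u) - normal_form (\<Sum>m\<in>UNIV. c $ m *s d m) =
      pvar x * (pmonom u - normal_form c) +
      (\<Sum>m\<in>UNIV. pconst (c $ m) * (pvar x * pmonom (t m) - normal_form (d m)))"
      unfolding nf[OF finite_class.finite_UNIV] pmonom_add
      by (simp add: normal_form_def[of c] pvar_def algebra_simps sum_subtractf sum_distrib_left)
    also have "\<dots> \<in> I" by (rule I_closed(2)[OF I_closed(3)[OF c] sum[OF finite_class.finite_UNIV]])
    finally show ?case by blast
  qed
  then obtain c where "pmonom u - normal_form c \<in> I" by blast
  from I_closed(3)[OF this, of "pconst a"] show ?case
    by (intro exI[of _ "a *s c"]) (simp add: normal_form_simps single_eq_const_mult algebra_simps)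
qed

text \<open>
  The key to border bases: the generators of \<open>I\<close> annihilate the generator of the module, and
  conversely a polynomial in the annihilator has a normal form with zero coordinates. So the residue
  class ring is the space of column vectors, with the order ideal as basis.
\<close>

lemma in_I_iff: "p \<in> I \<longleftrightarrow> coords p = 0"
proof -
  interpret cring "pring :: ('n, 'l) mpoly ring" by (rule cring_pring)
  have sub: "I \<subseteq> {p. coords p = 0}"
    unfolding point_ideal_def
  proof (rule genideal_minimal)
    show "ideal {p. coords p = 0} pring"
    proof (rule idealI)
      show "subgroup {p. coords p = 0} (add_monoid pring)"
        using coords_diff[of 0] by (intro add.subgroupI) (auto simp: coords_add intro: exI[of _ 0])
    qed (use coords_mult_0 in \<open>auto simp: ring_axioms mult.commute\<close>)
    have "coords (pmonom (b j) - normal_form (\<chi> i. \<gamma> (i, j))) = 0" for j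
      by (simp add: coords_diff coords_monom coords_normal_form tvec_b)
    then show "range (\<lambda>j. pmonom (b j) - (\<Sum>i\<in>UNIV. pconst (\<gamma> (i, j)) * pmonom (t i))) \<subseteq> {p. coords p = 0}"
      by (auto simp: normal_form_def)
  qed
  show ?thesis
  proof
    assume 0: "coords p = 0"
    obtain c where c: "p - normal_form c \<in> I" using reduce_mod_I by blast
    then have "coords p = c" using sub by (auto simp: coords_diff coords_normal_form)
    then show "p \<in> I" using c 0 by (simp add: normal_form_def pconst_simps)
  qed (use sub in blast)
qed

lemma residue_eq: "residue I p = {q. coords q = coords p}"
proof -
  have "residue I p = (\<lambda>h. h + p) ` I"
    by (auto simp: residue_def a_r_coset_def r_coset_def)
  also have "\<dots> = {q. coords q = coords p}"
    by (force simp: in_I_iff coords_add coords_diff intro!: image_eqI[of _ _ "x - p" for x])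
  finally show ?thesis .
qed

lemma residue_eq_iff: "residue I p = residue I q \<longleftrightarrow> coords p = coords q"
  unfolding residue_eq by auto

abbreviation R where "R \<equiv> residue_ring I"

lemma ring_R: "ring R"
  unfolding residue_ring_def by (rule ideal.quotient_is_ring[OF ideal_I])

lemma R_simps:
  "carrier R = range (residue I)"
  "residue I p \<otimes>\<^bsub>R\<^esub> residue I q = residue I (p * q)"
  "residue I p \<oplus>\<^bsub>R\<^esub> residue I q = residue I (p + q)"
  "\<zero>\<^bsub>R\<^esub> = residue I 0"
proof -
  interpret ideal I "pring :: ('n, 'l) mpoly ring" by (rule ideal_I)
  show "carrier R = range (residue I)"
    by (auto simp: residue_ring_def FactRing_def A_RCOSETS_def' residue_def)
  show "residue I p \<otimes>\<^bsub>R\<^esub> residue I q = residue I (p * q)"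
    using rcoset_mult_add[of p q] by (simp add: residue_ring_def FactRing_def residue_def)
  show "residue I p \<oplus>\<^bsub>R\<^esub> residue I q = residue I (p + q)"
    using a_rcos_sum[of p q] by (simp add: residue_ring_def FactRing_def residue_def)
  show "\<zero>\<^bsub>R\<^esub> = residue I 0"
    by (simp add: residue_ring_def FactRing_def residue_eq) (auto simp: in_I_iff)
qed

text \<open>
  Subsets of the residue class ring are described by their coordinate vectors; linear algebra over
  the embedded field of scalars thereby becomes linear algebra of column vectors.
\<close>

definition "class_set S = residue I ` {p. coords p \<in> S}"

lemma residue_in_classes: "residue I p \<in> class_set S \<longleftrightarrow> coords p \<in> S"
  unfolding class_set_def by (auto simp: residue_eq_iff)

lemma classes_eq_iff: "class_set S = class_set T \<longleftrightarrow> S = T"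
proof
  assume eq: "class_set S = class_set T"
  have "c \<in> S \<longleftrightarrow> c \<in> T" for c
    using eq residue_in_classes[of "normal_form c"] by (auto simp: coords_normal_form)
  then show "S = T" by blast
qed simp

lemma classes_0: "{\<zero>\<^bsub>R\<^esub>} = class_set {0}"
  unfolding class_set_def R_simps using residue_eq_iff[of _ 0] by (auto intro: image_eqI[of _ _ 0])

lemma line_extension_classes:
  "ring.line_extension R (scalars I) (residue I p) (class_set (vec.span S)) = class_set (vec.span (insert (coords p) S))"
proof -
  have "ring.line_extension R (scalars I) (residue I p) (class_set (vec.span S)) =
      {residue I (pconst c * p + q) | c q. coords q \<in> vec.span S}"
    unfolding ring.line_extension_def[OF ring_R] scalars_def class_set_def
    by (force simp: set_add_def set_mult_def r_coset_def R_simps)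
  also have "\<dots> = class_set (vec.span (insert (coords p) S))"
  proof (intro Set.set_eqI iffI)
    fix x assume "x \<in> {residue I (pconst c * p + q) | c q. coords q \<in> vec.span S}"
    then obtain c q where "x = residue I (pconst c * p + q)" "coords q \<in> vec.span S" by blast
    then show "x \<in> class_set (vec.span (insert (coords p) S))"
      by (auto simp: residue_in_classes coords_add coords_const_mult vec.span_insert intro!: exI[of _ c])
  next
    fix x assume "x \<in> class_set (vec.span (insert (coords p) S))"
    then obtain q c where q: "x = residue I q" "coords q - c *s coords p \<in> vec.span S"
      by (auto simp: class_set_def vec.span_insert)
    then have "x = residue I (pconst c * p + (q - pconst c * p))" "coords (q - pconst c * p) \<in> vec.span S"
      by (auto simp: coords_diff coords_const_mult)
    then show "x \<in> {residue I (pconst c * p + q) | c q. coords q \<in> vec.span S}" by blast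
  qed
  finally show ?thesis .
qed

lemma Span_classes:
  "ring.Span R (scalars I) (map (\<lambda>u. residue I (pmonom u)) us) = class_set (vec.span (tvec ` set us))"
  by (induction us)
    (simp_all add: ring.Span.simps[OF ring_R] classes_0 line_extension_classes coords_monom)

lemma independent_classes:
  "ring.independent R (scalars I) (map (\<lambda>u. residue I (pmonom u)) us) \<longleftrightarrow>
    distinct (map tvec us) \<and> vec.independent (tvec ` set us)"
proof (induction us)
  case Nil
  then show ?case by (simp add: ring.li_Nil[OF ring_R] vec.independent_empty)
next
  case (Cons u us)
  let ?us = "map (\<lambda>u. residue I (pmonom u)) us"
  have "ring.independent R (scalars I) (residue I (pmonom u) # ?us) \<longleftrightarrow>
    residue I (pmonom u) \<notin> ring.Span R (scalars I) ?us \<and> ring.independent R (scalars I) ?us"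
    using ring.independent_backwards[OF ring_R] ring.li_Cons[OF ring_R] R_simps(1) by blast
  also have "\<dots> \<longleftrightarrow> tvec u \<notin> vec.span (tvec ` set us) \<and> distinct (map tvec us) \<and> vec.independent (tvec ` set us)"
    by (simp only: Span_classes residue_in_classes coords_monom Cons.IH)
  also have "\<dots> \<longleftrightarrow> distinct (map tvec (u # us)) \<and> vec.independent (tvec ` set (u # us))"
    using vec.independent_insert[of "tvec u" "tvec ` set us"] vec.span_base[of "tvec u" "tvec ` set us"]
    by (auto simp: insert_absorb)
  finally show ?case by simp
qed

lemma dimension_imp_classes:
  "ring.dimension R n K E \<Longrightarrow> K = scalars I \<Longrightarrow> \<exists>S. E = class_set (vec.span S) \<and> vec.dim S = n"
proof (induction rule: ring.dimension.induct[OF ring_R, consumes 1])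
  case (1 K)
  then show ?case by (intro exI[of _ "{}"]) (simp add: classes_0)
next
  case (2 v E n K)
  then obtain S where S: "E = class_set (vec.span S)" "vec.dim S = n" by blast
  obtain p where p: "v = residue I p" using 2 by (auto simp: R_simps)
  have "coords p \<notin> vec.span S" using 2 S p by (simp add: residue_in_classes)
  then have "vec.dim (insert (coords p) S) = Suc n" using S by (simp add: vec.dim_insert)
  moreover have "ring.line_extension R K v E = class_set (vec.span (insert (coords p) S))"
    using line_extension_classes 2 S p by simp
  ultimately show ?case by blast
qed

lemma classes_dimension:
  "finite S \<Longrightarrow> vec.independent S \<Longrightarrow> ring.dimension R (card S) (scalars I) (class_set (vec.span S))"
proof (induction S rule: finite_induct)
  case empty
  show ?case using ring.zero_dim[OF ring_R] by (simp add: classes_0)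
next
  case (insert v S)
  have dim: "ring.dimension R (card S) (scalars I) (class_set (vec.span S))"
    using insert vec.independent_mono by blast
  have "v \<notin> vec.span S" using insert by (simp add: vec.independent_insert)
  then have "residue I (normal_form v) \<notin> class_set (vec.span S)"
    by (simp add: residue_in_classes coords_normal_form)
  then have "ring.dimension R (Suc (card S)) (scalars I)
      (ring.line_extension R (scalars I) (residue I (normal_form v)) (class_set (vec.span S)))"
    using dim by (intro ring.Suc_dim[OF ring_R]) (auto simp: R_simps)
  then show ?case using insert by (simp add: line_extension_classes coords_normal_form)
qed

text \<open>
  The dimension is a definite description. Uniqueness holds because every chain of line extensions
  consists of coordinate spans, whose dimension grows by one in each step.
\<close>

lemma dim_classes: "ring.dim R (scalars I) (class_set (vec.span S)) = vec.dim S"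
proof -
  obtain B where B: "B \<subseteq> S" "vec.independent B" "S \<subseteq> vec.span B" "card B = vec.dim S"
    by (rule vec.basis_exists)
  have span: "vec.span B = vec.span S"
    by (intro equalityI vec.span_mono[OF B(1)] vec.span_minimal[OF B(3)] vec.subspace_span)
  have "ring.dimension R (vec.dim S) (scalars I) (class_set (vec.span S))"
    using classes_dimension[OF vec.finiteI_independent[OF B(2)] B(2)] B(4) span by simp
  moreover have "n = vec.dim S" if n: "ring.dimension R n (scalars I) (class_set (vec.span S))" for n
  proof -
    obtain T where "class_set (vec.span S) = class_set (vec.span T)" "vec.dim T = n"
      using dimension_imp_classes[OF n refl] by blast
    then show ?thesis by (metis classes_eq_iff vec.dim_span)
  qed
  ultimately show ?thesis unfolding ring.dim_def[OF ring_R] over_def by (rule the_equality)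
qed

abbreviation V where "V d \<equiv> tvec ` {u. tdeg u \<le> d}"

lemma degree_filt_eq: "degree_filt I d = class_set (vec.span (V d))"
proof -
  have "coords p \<in> vec.span (V d)" if "\<forall>u\<in>Poly_Mapping.keys p. tdeg u \<le> d" for p
    unfolding coords_def using that by (intro vec.span_sum vec.span_scale vec.span_base) auto
  moreover have "\<exists>q. (\<forall>u\<in>Poly_Mapping.keys q. tdeg u \<le> d) \<and> coords q = c" if "c \<in> vec.span (V d)" for c
    using that
  proof (induction rule: vec.span_induct_alt)
    case base
    show ?case by (intro exI[of _ 0]) simp
  next
    case (step a x y)
    then obtain q u where q: "\<forall>u\<in>Poly_Mapping.keys q. tdeg u \<le> d" "coords q = y" and u: "x = tvec u" "tdeg u \<le> d"
      by blast
    have "Poly_Mapping.keys (Poly_Mapping.single u a + q) \<subseteq> insert u (Poly_Mapping.keys q)"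
      using keys_add[of "Poly_Mapping.single u a" q] by (auto split: if_splits)
    then show ?case
      using q u by (intro exI[of _ "Poly_Mapping.single u a + q"]) (auto simp: coords_add coords_single)
  qed
  ultimately show ?thesis
    unfolding degree_filt_def class_set_def using residue_eq_iff by (auto simp: image_iff) metis
qed

theorem HFa_eq_dim: "HFa I d = vec.dim (V d)"
  by (simp add: HFa_def degree_filt_eq dim_classes)

theorem degree_filtered_basis_iff:
  assumes fin: "finite \<O>'"
  shows "degree_filtered_basis \<O>' I \<longleftrightarrow>
    (\<forall>d. inj_on tvec {u \<in> \<O>'. tdeg u \<le> d} \<and> vec.independent (tvec ` {u \<in> \<O>'. tdeg u \<le> d}) \<and>
      vec.span (tvec ` {u \<in> \<O>'. tdeg u \<le> d}) = vec.span (V d))"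
proof -
  have "(\<exists>us. distinct us \<and> set us = U \<and>
      (let rs = map (\<lambda>u. residue I (pmonom u)) us in
        ring.independent R (scalars I) rs \<and> ring.Span R (scalars I) rs = degree_filt I d)) \<longleftrightarrow>
    inj_on tvec U \<and> vec.independent (tvec ` U) \<and> vec.span (tvec ` U) = vec.span (V d)" if "finite U" for U d
  proof -
    obtain us where "distinct us" "set us = U" using finite_distinct_list \<open>finite U\<close> by blast
    then show ?thesis
      by (auto simp: Let_def independent_classes Span_classes degree_filt_eq classes_eq_iff distinct_map
          simp del: ring.Span.simps[OF ring_R])
  qed
  from this[of "{u \<in> \<O>'. tdeg u \<le> d}" for d] show ?thesis
    unfolding degree_filtered_basis_def using fin by simp
qed

lemma HF_ord_le_HFa: "HF_ord (range t) d \<le> HFa I d"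
proof -
  let ?U = "{u \<in> range t. tdeg u \<le> d}"
  have inj: "inj_on tvec ?U"
    by (auto simp: inj_on_def tvec_t axis_eq_axis)
  have "tvec ` ?U \<subseteq> cart_basis" by (auto simp: tvec_t cart_basis_def)
  then have "vec.independent (tvec ` ?U)"
    using independent_cart_basis vec.independent_mono by blast
  then have "card (tvec ` ?U) \<le> vec.dim (V d)"
    by (intro vec.independent_card_le_dim) auto
  then show ?thesis using inj by (simp add: HF_ord_def HFa_eq_dim card_image)
qed

lemma HFa_le_card: "HFa I d \<le> CARD('m)"
  unfolding HFa_eq_dim using vec.dim_subset_UNIV[of "V d"] by (simp add: vec.dimension_def card_cart_basis)

lemma HFa_mono: "d \<le> e \<Longrightarrow> HFa I d \<le> HFa I e"
  unfolding HFa_eq_dim by (rule vec.dim_subset) auto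

lemma HFa_0: "HFa I 0 = 1"
proof -
  have "V 0 = {tvec 0}" by auto
  moreover have "tvec 0 \<noteq> 0" by (simp add: tvec_0 axis_eq_0_iff)
  ultimately show ?thesis by (simp add: HFa_eq_dim vec.dim_insert)
qed

end

section \<open>Evaluating generic multiplication matrices\<close>

definition eval_mat :: "('v \<Rightarrow> 'k::field alg_closure) \<Rightarrow> ('v, 'k) mpoly ^ 'i ^ 'j \<Rightarrow> 'k alg_closure ^ 'i ^ 'j"
  where "eval_mat \<gamma> M = (\<chi> i j. eval_at \<gamma> (M $ i $ j))"

lemma eval_mat_mult: "eval_mat \<gamma> (M ** N) = eval_mat \<gamma> M ** eval_mat \<gamma> N"
  by (simp add: eval_mat_def matrix_matrix_mult_def eval_at_sum eval_at_mult)

lemma eval_mat_1: "eval_mat \<gamma> (Finite_Cartesian_Product.mat 1) = Finite_Cartesian_Product.mat 1"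
  by (simp add: eval_mat_def Finite_Cartesian_Product.mat_def Finite_Cartesian_Product.vec_eq_iff)

lemma eval_mat_pow: "eval_mat \<gamma> (mat_pow M k) = mat_pow (eval_mat \<gamma> M) k"
  by (induction k) (simp_all add: mat_pow_def eval_mat_1 eval_mat_mult)

lemma eval_mat_term: "eval_mat \<gamma> (term_mat M u) = term_mat (\<lambda>x. eval_mat \<gamma> (M x)) u"
proof -
  have "eval_mat \<gamma> (foldr (\<lambda>x N. mat_pow (M x) (Poly_Mapping.lookup u x) ** N) xs (Finite_Cartesian_Product.mat 1)) =
    foldr (\<lambda>x N. mat_pow (eval_mat \<gamma> (M x)) (Poly_Mapping.lookup u x) ** N) xs (Finite_Cartesian_Product.mat 1)" for xs
    by (induction xs) (simp_all add: eval_mat_1 eval_mat_mult eval_mat_pow)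
  then show ?thesis by (simp add: term_mat_def)
qed

lemma eval_mat_generic: "eval_mat \<gamma> (generic_mult_mat t b r) = mult_mat_at t b \<gamma> r"
  by (simp add: eval_mat_def generic_mult_mat_def mult_mat_at_def Let_def Finite_Cartesian_Product.vec_eq_iff)

lemma eval_at_det: "eval_at \<gamma> (Determinants.det M) = Determinants.det (eval_mat \<gamma> M)"
proof -
  have sgn: "eval_at \<gamma> (of_int (sign p)) = of_int (sign p)" for p :: "'d \<Rightarrow> 'd"
    by (cases p rule: sign_cases) (simp_all add: eval_at_uminus)
  show ?thesis
    by (simp add: Determinants.det_def eval_at_sum eval_at_mult eval_at_prod eval_mat_def sgn)
qed

lemma eval_at_minor:
  "eval_at \<gamma> (Determinant.det (Matrix.mat k k f)) = Determinant.det (Matrix.mat k k (\<lambda>xy. eval_at \<gamma> (f xy)))"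
proof -
  interpret comm_ring_hom "eval_at \<gamma>"
    by unfold_locales (simp_all add: eval_at_add eval_at_mult)
  have "map_mat (eval_at \<gamma>) (Matrix.mat k k f) = Matrix.mat k k (\<lambda>xy. eval_at \<gamma> (f xy))"
    by (rule eq_matI) auto
  then show ?thesis using hom_det[of "Matrix.mat k k f"] by simp
qed

lemma vanishes_on_Idl: "(\<forall>f \<in> Idl\<^bsub>pring\<^esub> S. eval_at \<gamma> f = 0) \<longleftrightarrow> (\<forall>f \<in> S. eval_at \<gamma> f = 0)"
proof -
  have "(\<forall>f \<in> T. eval_at \<gamma> f = 0) \<longleftrightarrow> spec_point \<gamma> \<in> zero_locus pring T" for T
    using spec_point_in_Spec by (auto simp: zero_locus_def spec_point_def)
  then show ?thesis by (simp add: zero_locus_Idl)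
qed

lemma prime_contains_INT:
  assumes p: "primeideal p (pring :: 'a::comm_ring_1 ring)" and fin: "finite S"
    and ideals: "\<And>i. i \<in> S \<Longrightarrow> ideal (B i) pring"
  shows "(\<Inter>i\<in>S. B i) \<subseteq> p \<longleftrightarrow> (\<exists>i\<in>S. B i \<subseteq> p)"
proof
  assume sub: "(\<Inter>i\<in>S. B i) \<subseteq> p"
  show "\<exists>i\<in>S. B i \<subseteq> p"
  proof (rule ccontr)
    assume "\<not> (\<exists>i\<in>S. B i \<subseteq> p)"
    then have "\<forall>i\<in>S. \<exists>g. g \<in> B i \<and> g \<notin> p" by blast
    then obtain f where f: "\<And>i. i \<in> S \<Longrightarrow> f i \<in> B i \<and> f i \<notin> p" by (auto dest!: bchoice)
    interpret p: primeideal p "pring :: 'a ring" by fact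
    have "prod f T \<notin> p" if "T \<subseteq> S" for T
      using finite_subset[OF that fin] that
    proof induction
      case empty
      then show ?case using p.one_imp_carrier p.I_notcarr by auto
    next
      case (insert i T)
      then show ?case using p.I_prime[of "f i" "prod f T"] f[of i] by auto
    qed
    moreover have "prod f S \<in> B i" if "i \<in> S" for i
      using ideal.I_r_closed[OF ideals[OF that], of "f i" "prod f (S - {i})"] f[OF that]
      by (simp add: prod.remove[OF fin that])
    ultimately show False using sub by blast
  qed
qed blast

lemma ideal_Idl: "ideal (Idl\<^bsub>pring\<^esub> S) (pring :: 'a::comm_ring_1 ring)"
proof -
  interpret cring "pring :: 'a ring" by (rule cring_pring)
  show ?thesis by (rule genideal_ideal) simp
qed

lemma ideal_HF_ideal: "ideal (HF_ideal t b G) pring"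
  unfolding HF_ideal_def by (rule ideal_Idl)

section \<open>Loci of bounded Hilbert function\<close>

text \<open>
  The Hilbert function of a scheme of length \<open>\<mu>\<close> starts with 1 and never exceeds \<open>\<mu>\<close>, so for such a
  bound \<open>G\<close> only the degrees from 1 up to the first value \<open>\<mu>\<close> give a condition; these are the
  degrees whose minors occur in the ideal attached to \<open>G\<close>.
\<close>

definition length_bound :: "nat \<Rightarrow> (nat \<Rightarrow> nat) \<Rightarrow> bool"
  where "length_bound \<mu> G \<longleftrightarrow> 1 \<le> G 0 \<and> (\<forall>j \<ge> (LEAST i. G i = \<mu>). \<mu> \<le> G j)"

text \<open>
  The parameter \<open>K\<close> fixes the type of the ground field.
\<close>

locale border_basis_scheme =
  fixes t :: "'m::{finite,linorder} \<Rightarrow> 'n::{finite,linorder} pterm"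
    and b :: "'b::finite \<Rightarrow> 'n pterm"
    and K :: "'k::field itself"
  assumes enum: "order_ideal_enum t"
    and inj_b: "inj b" and range_b: "range b = border (range t)"
begin

lemma bb_points_iff:
  fixes \<gamma> :: "'m \<times> 'b \<Rightarrow> 'k alg_closure"
  shows "\<gamma> \<in> bb_points t b \<longleftrightarrow> border_basis_point t b \<gamma>"
proof -
  let ?G = "generic_mult_mat t b :: 'n \<Rightarrow> _"
  have "\<gamma> \<in> bb_points t b \<longleftrightarrow> (\<forall>r s. \<forall>i j. eval_at \<gamma> ((?G r ** ?G s - ?G s ** ?G r) $ i $ j) = 0)"
    unfolding bb_points_def bb_ideal_def vanishes_on_Idl mem_Collect_eq by blast
  also have "\<dots> \<longleftrightarrow> (\<forall>r s. eval_mat \<gamma> (?G r ** ?G s) = eval_mat \<gamma> (?G s ** ?G r))"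
    by (simp add: eval_at_diff eval_mat_def Finite_Cartesian_Product.vec_eq_iff)
  also have "\<dots> \<longleftrightarrow> border_basis_point t b \<gamma>"
    unfolding eval_mat_mult eval_mat_generic border_basis_point_def
    using enum inj_b range_b by blast
  finally show ?thesis .
qed

lemma eval_first_column:
  fixes \<gamma> :: "'m \<times> 'b \<Rightarrow> 'k alg_closure"
  assumes "border_basis_point t b \<gamma>"
  shows "eval_at \<gamma> (first_column_entry t b u i) = border_basis_point.tvec t b \<gamma> u $ i"
proof -
  interpret border_basis_point t b \<gamma> by fact
  have "eval_at \<gamma> (first_column_entry t b u i) = eval_mat \<gamma> (term_mat (generic_mult_mat t b) u) $ i $ Min UNIV"
    by (simp add: first_column_entry_def eval_mat_def)
  then show ?thesis
    by (simp add: eval_mat_term eval_mat_generic tvec_def column_def)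
qed

lemma minors_vanish_iff:
  fixes \<gamma> :: "'m \<times> 'b \<Rightarrow> 'k alg_closure"
  assumes "border_basis_point t b \<gamma>"
  shows "(\<forall>f \<in> minors t b d k. eval_at \<gamma> f = 0) \<longleftrightarrow> HFa (point_ideal t b \<gamma>) d < k"
proof -
  interpret border_basis_point t b \<gamma> by fact
  have ev: "eval_at \<gamma> (Determinant.det (Matrix.mat k k (\<lambda>(x, y). first_column_entry t b (q y) (p x)))) =
      Determinant.det (Matrix.mat k k (\<lambda>(x, y). tvec (q y) $ p x))" for p q
    unfolding eval_at_minor by (simp add: case_prod_unfold eval_first_column[OF assms])
  have "(\<exists>f \<in> minors t b d k. eval_at \<gamma> f \<noteq> 0) \<longleftrightarrow>
    (\<exists>p q. inj_on p {..<k} \<and> inj_on q {..<k} \<and> q ` {..<k} \<subseteq> {u. tdeg u \<le> d} \<and>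
      eval_at \<gamma> (Determinant.det (Matrix.mat k k (\<lambda>(x, y). first_column_entry t b (q y) (p x)))) \<noteq> 0)"
    unfolding minors_def by blast
  also have "\<dots> \<longleftrightarrow> k \<le> HFa I d"
    by (simp only: ev HFa_eq_dim le_dim_iff_minor)
  finally have "(\<exists>f \<in> minors t b d k. eval_at \<gamma> f \<noteq> 0) \<longleftrightarrow> k \<le> HFa I d" .
  then show ?thesis by (metis not_le)
qed

lemma eval_T_det:
  fixes \<gamma> :: "'m \<times> 'b \<Rightarrow> 'k alg_closure"
  assumes "border_basis_point t b \<gamma>"
  shows "eval_at \<gamma> (T_det t b t') \<noteq> 0 \<longleftrightarrow>
    inj (\<lambda>j. border_basis_point.tvec t b \<gamma> (t' j)) \<and>
    vec.independent (range (\<lambda>j. border_basis_point.tvec t b \<gamma> (t' j)))"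
proof -
  have "eval_at \<gamma> (T_det t b t') = Determinants.det (\<chi> i j. border_basis_point.tvec t b \<gamma> (t' j) $ i)"
    unfolding T_det_def eval_at_det by (simp add: eval_mat_def eval_first_column[OF assms])
  then show ?thesis by (simp add: independent_columns_iff_det)
qed

lemma HF_ideal_vanishes_iff:
  fixes \<gamma> :: "'m \<times> 'b \<Rightarrow> 'k alg_closure"
  assumes G: "length_bound CARD('m) G"
  shows "(\<forall>f \<in> HF_ideal t b G. eval_at \<gamma> f = 0) \<longleftrightarrow>
    \<gamma> \<in> bb_points t b \<and> HFa (point_ideal t b \<gamma>) \<le> G"
proof -
  let ?\<sigma> = "LEAST i. G i = CARD('m)"
  have "(\<forall>f \<in> HF_ideal t b G. eval_at \<gamma> f = 0) \<longleftrightarrow>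
    \<gamma> \<in> bb_points t b \<and> (\<forall>i \<in> {1..<?\<sigma>}. \<forall>f \<in> Idl\<^bsub>pring\<^esub> (minors t b i (G i + 1)). eval_at \<gamma> f = 0)"
    by (simp add: HF_ideal_def vanishes_on_Idl bb_points_def ball_Un)
  also have "\<dots> \<longleftrightarrow> \<gamma> \<in> bb_points t b \<and> (\<forall>i \<in> {1..<?\<sigma>}. HFa (point_ideal t b \<gamma>) i \<le> G i)"
    by (rule conj_cong[OF refl]) (simp add: vanishes_on_Idl bb_points_iff minors_vanish_iff less_Suc_eq_le)
  also have "\<dots> \<longleftrightarrow> \<gamma> \<in> bb_points t b \<and> HFa (point_ideal t b \<gamma>) \<le> G"
  proof (rule conj_cong[OF refl])
    assume "\<gamma> \<in> bb_points t b"
    then interpret border_basis_point t b \<gamma> by (simp add: bb_points_iff)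
    have "HFa I i \<le> G i" if "i \<notin> {1..<?\<sigma>}" for i
    proof (cases "i = 0")
      case True
      then show ?thesis using G HFa_0 by (simp add: length_bound_def)
    next
      case False
      then have "CARD('m) \<le> G i" using that G by (simp add: length_bound_def)
      then show ?thesis using HFa_le_card[of i] by linarith
    qed
    then show "(\<forall>i \<in> {1..<?\<sigma>}. HFa I i \<le> G i) \<longleftrightarrow> HFa I \<le> G"
      unfolding le_fun_def by blast
  qed
  finally show ?thesis .
qed

theorem HF_closed_sub_eq:
  assumes "length_bound CARD('m) G"
  shows "(HF_closed_sub t b G :: ('m \<times> 'b, 'k) mpoly set set) = zero_locus pring (HF_ideal t b G)"
  unfolding HF_closed_sub_def
  using closure_of_points[of "HF_ideal t b G :: ('m \<times> 'b, 'k) mpoly set"] HF_ideal_vanishes_iff[OF assms]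
  by simp

end

section \<open>The locus of degree filtered bases\<close>

locale filtered_basis_scheme = border_basis_scheme t b K
  for t :: "'m::{finite,linorder} \<Rightarrow> 'n::{finite,linorder} pterm"
    and b :: "'b::finite \<Rightarrow> 'n pterm"
    and K :: "'k::field itself" +
  fixes t' :: "'m \<Rightarrow> 'n pterm" and H :: "nat \<Rightarrow> nat"
  assumes enum': "order_ideal_enum t'"
    and H: "H = HF_ord (range t')"
begin

lemma H_le: "H d \<le> CARD('m)"
proof -
  have "H d \<le> card (range t')" unfolding H HF_ord_def by (rule card_mono) auto
  also have "\<dots> \<le> CARD('m)" by (rule card_image_le) simp
  finally show ?thesis .
qed

lemma H_mono: "d \<le> e \<Longrightarrow> H d \<le> H e"
  unfolding H HF_ord_def by (rule card_mono) auto

lemma H_0: "H 0 = 1"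
proof -
  obtain i where "i \<in> (UNIV :: 'm set)" by blast
  have "0 + t' i \<in> range t'" by simp
  then have "0 \<in> range t'" using enum' unfolding order_ideal_enum_def order_ideal_def by metis
  then have "{u \<in> range t'. tdeg u \<le> 0} = {0}" by auto
  then show ?thesis by (simp add: H HF_ord_def)
qed

lemma H_pos: "1 \<le> H d"
  using H_mono[of 0 d] H_0 by simp

definition \<rho> where "\<rho> = (LEAST i. H i = CARD('m))"

lemma H_full: "H (Max (range (\<lambda>i. tdeg (t' i)))) = CARD('m)"
proof -
  have "{u \<in> range t'. tdeg u \<le> Max (range (\<lambda>i. tdeg (t' i)))} = range t'" by auto
  then show ?thesis using enum' by (simp add: H HF_ord_def order_ideal_enum_def card_image)
qed

lemma H_\<rho>: "\<rho> \<le> j \<Longrightarrow> H j = CARD('m)"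
  using LeastI[of "\<lambda>i. H i = CARD('m)", OF H_full] H_mono[of \<rho> j] H_le[of j]
  by (simp add: \<rho>_def)

lemma length_bound_H: "length_bound CARD('m) H"
  unfolding length_bound_def \<rho>_def[symmetric] using H_0 H_\<rho> by simp

text \<open>
  Lowering the bound in the degree \<open>\<rho>\<close> moves the first occurrence of the full length to \<open>\<rho> + 1\<close>;
  lowering it earlier keeps it at \<open>\<rho>\<close>.
\<close>

lemma length_bound_H': 
  assumes i: "i \<in> {1..\<rho>}"
  shows "length_bound CARD('m) (H(i := H i - 1))"
proof -
  let ?G = "H(i := H i - 1)"
  define \<sigma> where "\<sigma> = (LEAST k. ?G k = CARD('m))"
  have "?G (Suc \<rho>) = CARD('m)" using i H_\<rho>[of "Suc \<rho>"] by auto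
  then have \<sigma>: "?G \<sigma> = CARD('m)" unfolding \<sigma>_def by (rule LeastI)
  have ne: "\<sigma> \<noteq> i"
  proof
    assume "\<sigma> = i"
    then have "H i - 1 = CARD('m)" using \<sigma> by simp
    then show False using H_le[of i] H_pos[of i] by linarith
  qed
  then have H\<sigma>: "H \<sigma> = CARD('m)" using \<sigma> by simp
  then have "\<rho> \<le> \<sigma>" unfolding \<rho>_def by (rule Least_le)
  then have "i < \<sigma>" using i ne by auto
  have "CARD('m) \<le> ?G j" if "\<sigma> \<le> j" for j
    using H_mono[OF that] H\<sigma> that \<open>i < \<sigma>\<close> by simp
  moreover have "1 \<le> ?G 0" using i H_0 by simp
  ultimately show ?thesis unfolding length_bound_def \<sigma>_def by blast
qed

text \<open>
  The degrees in which a Hilbert function bounded by \<open>H\<close> can fall short of \<open>H\<close>: the order ideal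
  gives a lower bound for it, and a defect beyond \<open>\<rho>\<close> already shows at \<open>\<rho>\<close>.
\<close>

definition drops where "drops = {i \<in> {1..\<rho>}. HF_ord (range t) i \<le> H i - 1}"

lemma Z_ideal_eq: "Z_ideal t b H = (\<Inter>i\<in>drops. HF_ideal t b (H(i := H i - 1)))"
  by (simp add: Z_ideal_def drops_def \<rho>_def)

lemma prime_contains_Z:
  "primeideal p pring \<Longrightarrow> Z_ideal t b H \<subseteq> p \<longleftrightarrow> (\<exists>i\<in>drops. HF_ideal t b (H(i := H i - 1)) \<subseteq> p)"
  unfolding Z_ideal_eq by (rule prime_contains_INT) (auto simp: drops_def ideal_HF_ideal)

lemma Z_ideal_vanishes_iff:
  fixes \<gamma> :: "'m \<times> 'b \<Rightarrow> 'k alg_closure"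
  shows "(\<forall>f \<in> Z_ideal t b H. eval_at \<gamma> f = 0) \<longleftrightarrow> \<gamma> \<in> bb_points t b \<and> HFa (point_ideal t b \<gamma>) < H"
proof -
  have "(\<forall>f \<in> Z_ideal t b H. eval_at \<gamma> f = 0) \<longleftrightarrow> Z_ideal t b H \<subseteq> spec_point \<gamma>"
    by (auto simp: spec_point_def)
  also have "\<dots> \<longleftrightarrow> (\<exists>i\<in>drops. HF_ideal t b (H(i := H i - 1)) \<subseteq> spec_point \<gamma>)"
    using spec_point_in_Spec by (intro prime_contains_Z) (simp add: Spec_def)
  also have "\<dots> \<longleftrightarrow> (\<exists>i\<in>drops. \<forall>f \<in> HF_ideal t b (H(i := H i - 1)). eval_at \<gamma> f = 0)"
    by (auto simp: spec_point_def)
  also have "\<dots> \<longleftrightarrow> (\<exists>i\<in>drops. \<gamma> \<in> bb_points t b \<and> HFa (point_ideal t b \<gamma>) \<le> H(i := H i - 1))"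
    using HF_ideal_vanishes_iff[OF length_bound_H'] by (intro bex_cong refl) (simp add: drops_def)
  also have "\<dots> \<longleftrightarrow> \<gamma> \<in> bb_points t b \<and> HFa (point_ideal t b \<gamma>) < H"
  proof (cases "\<gamma> \<in> bb_points t b")
    case True
    then interpret border_basis_point t b \<gamma> by (simp add: bb_points_iff)
    have "(\<exists>i\<in>drops. HFa I \<le> H(i := H i - 1)) \<longleftrightarrow> HFa I < H"
    proof
      assume "\<exists>i\<in>drops. HFa I \<le> H(i := H i - 1)"
      then obtain i where i: "HFa I \<le> H(i := H i - 1)" by blast
      have lt: "HFa I i < H i" using le_funD[OF i, of i] H_pos[of i] by simp
      moreover have "HFa I \<le> H"
      proof (rule le_funI)
        fix j show "HFa I j \<le> H j" using le_funD[OF i, of j] lt by (cases "j = i") auto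
      qed
      ultimately show "HFa I < H" by (metis leD order_less_le le_funD)
    next
      assume lt: "HFa I < H"
      then obtain i where i: "HFa I i < H i" by (metis le_funI less_le_not_le not_le)
      define k where "k = min i \<rho>"
      have k: "HFa I k < H k"
      proof (cases "i \<le> \<rho>")
        case False
        then have "HFa I \<rho> \<le> HFa I i" "H i \<le> H \<rho>" using HFa_mono H_le H_\<rho>[of \<rho>] by auto
        then show ?thesis using i False by (simp add: k_def)
      qed (use i in \<open>simp add: k_def\<close>)
      have "k \<noteq> 0" using k HFa_0 H_0 by (metis less_irrefl)
      then have "k \<in> drops"
        using k HF_ord_le_HFa[of k] by (auto simp: drops_def k_def)
      moreover have "HFa I \<le> H(k := H k - 1)"
        using le_funD[OF less_imp_le[OF lt]] k by (auto simp: le_fun_def)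
      ultimately show "\<exists>i\<in>drops. HFa I \<le> H(i := H i - 1)" by blast
    qed
    then show ?thesis using True by simp
  qed simp
  finally show ?thesis .
qed

lemma HF_sub_eq:
  "(HF_sub t b H :: ('m \<times> 'b, 'k) mpoly set set) =
    zero_locus pring (HF_ideal t b H) - zero_locus pring (Z_ideal t b H)"
  unfolding HF_sub_def HF_closed_sub_eq[OF length_bound_H]
  using closure_of_points[of "Z_ideal t b H :: ('m \<times> 'b, 'k) mpoly set"] Z_ideal_vanishes_iff
  by simp

text \<open>
  When the Hilbert function is \<open>H\<close>, independence of \<open>range t'\<close> suffices: the number of its terms
  of degree at most \<open>d\<close> is already the dimension of the corresponding filtration step.
\<close>

lemma degree_filtered_basis_point_iff:
  fixes \<gamma> :: "'m \<times> 'b \<Rightarrow> 'k alg_closure"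
  assumes "border_basis_point t b \<gamma>"
  shows "degree_filtered_basis (range t') (point_ideal t b \<gamma>) \<longleftrightarrow>
    HFa (point_ideal t b \<gamma>) = H \<and> eval_at \<gamma> (T_det t b t') \<noteq> 0"
proof -
  interpret border_basis_point t b \<gamma> by fact
  let ?O = "\<lambda>d. {u \<in> range t'. tdeg u \<le> d}"
  have inj_t': "inj t'" using enum' by (simp add: order_ideal_enum_def)
  have det: "eval_at \<gamma> (T_det t b t') \<noteq> 0 \<longleftrightarrow> inj_on tvec (range t') \<and> vec.independent (tvec ` range t')"
    unfolding eval_T_det[OF assms] using comp_inj_on_iff[OF inj_t', of tvec]
    by (simp only: comp_def image_image)
  have cardO: "card (?O d) = H d" for d by (simp add: H HF_ord_def)
  show ?thesis unfolding det degree_filtered_basis_iff[OF finite_imageI[OF finite_class.finite_UNIV]]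
  proof
    assume *: "\<forall>d. inj_on tvec (?O d) \<and> vec.independent (tvec ` ?O d) \<and> vec.span (tvec ` ?O d) = vec.span (V d)"
    have "HFa I d = H d" for d
    proof -
      have "vec.dim (V d) = card (tvec ` ?O d)" using * vec.dim_eq_card by blast
      then show ?thesis using * cardO by (simp add: HFa_eq_dim card_image)
    qed
    then have "HFa I = H" by (rule ext)
    moreover have all: "?O (Max (range (\<lambda>i. tdeg (t' i)))) = range t'" by auto
    have "inj_on tvec (range t') \<and> vec.independent (tvec ` range t')"
      using spec[OF *, of "Max (range (\<lambda>i. tdeg (t' i)))"] unfolding all by blast
    ultimately show "HFa I = H \<and> inj_on tvec (range t') \<and> vec.independent (tvec ` range t')" by blast
  next
    assume *: "HFa I = H \<and> inj_on tvec (range t') \<and> vec.independent (tvec ` range t')"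
    show "\<forall>d. inj_on tvec (?O d) \<and> vec.independent (tvec ` ?O d) \<and> vec.span (tvec ` ?O d) = vec.span (V d)"
    proof
      fix d
      have inj: "inj_on tvec (?O d)" using * by (auto intro: inj_on_subset)
      have "tvec ` ?O d \<subseteq> tvec ` range t'" by blast
      then have ind: "vec.independent (tvec ` ?O d)" using * vec.independent_mono by blast
      have sub: "tvec ` ?O d \<subseteq> V d" by blast
      have "vec.dim (V d) \<le> card (tvec ` ?O d)"
        using * inj cardO by (simp add: card_image flip: HFa_eq_dim)
      then have "V d \<subseteq> vec.span (tvec ` ?O d)" by (rule vec.card_ge_dim_independent[OF sub ind])
      then have "vec.span (tvec ` ?O d) = vec.span (V d)"
        by (intro equalityI vec.span_mono[OF sub] vec.span_minimal vec.subspace_span)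
      then show "inj_on tvec (?O d) \<and> vec.independent (tvec ` ?O d) \<and> vec.span (tvec ` ?O d) = vec.span (V d)"
        using inj ind by blast
    qed
  qed
qed

text \<open>
  A prime contains a sum of ideals iff it contains both, and an intersection iff it contains one
  of them.
\<close>

lemma zero_locus_J:
  "zero_locus pring (J_ideal t b t' H :: ('m \<times> 'b, 'k) mpoly set) =
    zero_locus pring (HF_ideal t b H) \<inter> (zero_locus pring (Z_ideal t b H) \<union> zero_locus pring {T_det t b t'})"
proof -
  have "J_ideal t b t' H \<subseteq> p \<longleftrightarrow> HF_ideal t b H \<subseteq> p \<and> (Z_ideal t b H \<subseteq> p \<or> T_det t b t' \<in> p)"
    if p: "primeideal p pring" for p :: "('m \<times> 'b, 'k) mpoly set"
  proof -
    let ?T = "Idl\<^bsub>pring\<^esub> {T_det t b t'} :: ('m \<times> 'b, 'k) mpoly set"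
    let ?D = "dfb_ideal t b t' H :: ('m \<times> 'b, 'k) mpoly set"
    let ?J = "J_ideal t b t' H :: ('m \<times> 'b, 'k) mpoly set"
    let ?F = "HF_ideal t b H :: ('m \<times> 'b, 'k) mpoly set"
    let ?Z = "Z_ideal t b H :: ('m \<times> 'b, 'k) mpoly set"
    interpret p: primeideal p "pring :: ('m \<times> 'b, 'k) mpoly ring" by fact
    interpret HF: ideal "?F" "pring :: ('m \<times> 'b, 'k) mpoly ring" by (rule ideal_HF_ideal)
    interpret T: ideal ?T "pring :: ('m \<times> 'b, 'k) mpoly ring" by (rule ideal_Idl)
    have Z_mult: "f * g \<in> ?Z" if "f \<in> ?Z" for f g
      using that ideal.I_r_closed[OF ideal_HF_ideal, of f t b _ g] by (auto simp: Z_ideal_eq)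
    have Z_0: "0 \<in> ?Z"
      using additive_subgroup.zero_closed[OF ideal.axioms(1)[OF ideal_HF_ideal]]
      by (force simp: Z_ideal_eq)
    have zHF: "0 \<in> ?F" using HF.zero_closed by simp
    have zT: "0 \<in> ?T" using T.zero_closed by simp
    have T: "?T \<subseteq> p \<longleftrightarrow> T_det t b t' \<in> p"
      using p.Idl_subset_ideal[of p "{T_det t b t'}"] p.is_ideal by simp
    have "?D \<subseteq> p \<longleftrightarrow> ?Z \<subseteq> p \<or> ?T \<subseteq> p"
    proof
      assume sub: "?D \<subseteq> p"
      show "?Z \<subseteq> p \<or> ?T \<subseteq> p"
      proof (rule ccontr)
        assume "\<not> (?Z \<subseteq> p \<or> ?T \<subseteq> p)"
        then obtain f g where "f \<in> ?Z" "f \<notin> p" "g \<in> ?T" "g \<notin> p" by blast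
        moreover from this have "f * g \<in> ?D"
          using Z_mult T.I_l_closed[of g f] by (simp add: dfb_ideal_def)
        ultimately show False using sub p.I_prime[of f g] by auto
      qed
    qed (auto simp: dfb_ideal_def)
    moreover have "?J \<subseteq> p \<longleftrightarrow> ?D \<subseteq> p \<and> ?F \<subseteq> p"
    proof
      assume sub: "?J \<subseteq> p"
      have add: "f + g \<in> ?J" if "f \<in> ?D" "g \<in> ?F" for f g
        using that by (auto simp: J_ideal_def set_add_def set_mult_def)
      have D_0: "0 \<in> ?D" using Z_0 zT by (simp add: dfb_ideal_def)
      have "f \<in> p" if "f \<in> ?D" for f using sub add[OF that zHF] by auto
      moreover have "g \<in> p" if "g \<in> ?F" for g using sub add[OF D_0 that] by auto
      ultimately show "?D \<subseteq> p \<and> ?F \<subseteq> p" by blast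
    next
      assume sub: "?D \<subseteq> p \<and> ?F \<subseteq> p"
      show "?J \<subseteq> p"
      proof
        fix h assume "h \<in> ?J"
        then obtain f g where "f \<in> ?D" "g \<in> ?F" "h = f + g"
          by (auto simp: J_ideal_def set_add_def set_mult_def)
        then show "h \<in> p"
          using sub additive_subgroup.a_closed[OF p.is_additive_subgroup, of f g] by auto
      qed
    qed
    ultimately show ?thesis using T by blast
  qed
  then show ?thesis by (auto simp: zero_locus_def Spec_def)
qed

text \<open>
  A prime of \<open>U\<close> outside \<open>U'\<close> would lie in the locally closed set where one polynomial of the
  ideal of the strictly dominated locus and one polynomial defining \<open>U\<close> do not vanish. By the
  Nullstellensatz that set has a geometric point, at which the two open sets differ.
\<close>

lemma open_sub_determined_by_points:
  fixes U U' :: "('m \<times> 'b, 'k) mpoly set set"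
  assumes U: "openin (subtopology (zariski pring) (HF_sub t b H)) U"
    and U': "openin (subtopology (zariski pring) (HF_sub t b H)) U'"
    and points: "\<And>\<gamma>. \<gamma> \<in> bb_points t b \<Longrightarrow> spec_point \<gamma> \<in> U \<Longrightarrow> spec_point \<gamma> \<in> U'"
  shows "U \<subseteq> U'"
proof
  fix p assume p: "p \<in> U"
  obtain S where S: "U = (Spec pring - zero_locus pring S) \<inter> HF_sub t b H"
    using U by (auto simp: openin_subtopology openin_zariski)
  obtain S' where S': "U' = (Spec pring - zero_locus pring S') \<inter> HF_sub t b H"
    using U' by (auto simp: openin_subtopology openin_zariski)
  have prime: "primeideal p pring" using p S by (simp add: Spec_def)
  interpret p: primeideal p "pring :: ('m \<times> 'b, 'k) mpoly ring" by (rule prime)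
  have pHF: "HF_ideal t b H \<subseteq> p" using p S by (simp add: HF_sub_eq zero_locus_def)
  obtain s where s: "s \<in> S" "s \<notin> p" using p S by (auto simp: zero_locus_def)
  obtain z where z: "z \<in> Z_ideal t b H" "z \<notin> p" using p S by (auto simp: HF_sub_eq zero_locus_def)
  show "p \<in> U'"
  proof (rule ccontr)
    assume "p \<notin> U'"
    then have pS': "S' \<subseteq> p" using p S S' by (auto simp: zero_locus_def)
    have "s * z \<notin> p" using s z p.I_prime[of s z] by auto
    then obtain \<gamma> where \<gamma>: "p \<subseteq> spec_point \<gamma>" "s * z \<notin> spec_point \<gamma>"
      using nullstellensatz[OF prime] by blast
    have "s \<notin> spec_point \<gamma>" "z \<notin> spec_point \<gamma>"
      using \<gamma>(2) by (auto simp: spec_point_def eval_at_mult)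
    moreover have "HF_ideal t b H \<subseteq> spec_point \<gamma>" using pHF \<gamma>(1) by blast
    ultimately have "spec_point \<gamma> \<in> U"
      using s z spec_point_in_Spec unfolding S HF_sub_eq by (auto simp: zero_locus_def)
    moreover have "spec_point \<gamma> \<notin> U'"
      using pS' \<gamma>(1) spec_point_in_Spec unfolding S' by (auto simp: zero_locus_def)
    moreover have "\<gamma> \<in> bb_points t b"
      using HF_ideal_vanishes_iff[OF length_bound_H, of \<gamma>] \<open>HF_ideal t b H \<subseteq> spec_point \<gamma>\<close>
      by (auto simp: spec_point_def)
    ultimately show False using points by blast
  qed
qed

lemma dfb_sub_eq:
  "(dfb_sub t b (range t') :: ('m \<times> 'b, 'k) mpoly set set) = HF_sub t b H - zero_locus pring {T_det t b t'}"
proof -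
  let ?U = "HF_sub t b H - zero_locus pring {T_det t b t'} :: ('m \<times> 'b, 'k) mpoly set set"
  have "is_dfb_sub t b (range t') ?U"
    unfolding is_dfb_sub_def
  proof (intro conjI ballI)
    have "HF_sub t b H \<subseteq> Spec (pring :: ('m \<times> 'b, 'k) mpoly ring)"
      by (auto simp: HF_sub_eq zero_locus_def)
    then have "?U = (Spec pring - zero_locus pring {T_det t b t'}) \<inter> HF_sub t b H" by blast
    moreover have "openin (zariski pring) (Spec (pring :: ('m \<times> 'b, 'k) mpoly ring) - zero_locus pring {T_det t b t'})"
      by (auto simp: openin_zariski)
    ultimately show "openin (subtopology (zariski pring) (HF_sub t b (HF_ord (range t')))) ?U"
      unfolding openin_subtopology H[symmetric] by blast
  next
    fix \<gamma> :: "'m \<times> 'b \<Rightarrow> 'k alg_closure" assume \<gamma>: "\<gamma> \<in> bb_points t b"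
    have "spec_point \<gamma> \<in> zero_locus pring F \<longleftrightarrow> (\<forall>f \<in> F. eval_at \<gamma> f = 0)" for F
      using spec_point_in_Spec by (auto simp: zero_locus_def spec_point_def)
    then have "spec_point \<gamma> \<in> ?U \<longleftrightarrow>
        HFa (point_ideal t b \<gamma>) \<le> H \<and> \<not> HFa (point_ideal t b \<gamma>) < H \<and> eval_at \<gamma> (T_det t b t') \<noteq> 0"
      using \<gamma> by (simp add: HF_sub_eq HF_ideal_vanishes_iff[OF length_bound_H] Z_ideal_vanishes_iff)
    also have "\<dots> \<longleftrightarrow> degree_filtered_basis (range t') (point_ideal t b \<gamma>)"
      using \<gamma> degree_filtered_basis_point_iff by (auto simp: bb_points_iff order_le_less)
    finally show "spec_point \<gamma> \<in> ?U \<longleftrightarrow> degree_filtered_basis (range t') (point_ideal t b \<gamma>)" .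
  qed
  moreover have "W = ?U" if "is_dfb_sub t b (range t') W" for W :: "('m \<times> 'b, 'k) mpoly set set"
    using that calculation open_sub_determined_by_points unfolding is_dfb_sub_def H[symmetric]
    by (intro equalityI) blast+
  ultimately show ?thesis unfolding dfb_sub_def by (rule the_equality)
qed

end

theorem mainTheorem9:
  fixes t t' :: "'m::{finite,linorder} \<Rightarrow> 'n::{finite,linorder} pterm"
    and b :: "'b::finite \<Rightarrow> 'n pterm"
    and H :: "nat \<Rightarrow> nat"
  assumes "order_ideal_enum t"
    and "inj b" and "range b = border (range t)"
    and "admissible TYPE(('n, 'k::field) mpoly) CARD('m) H"
    and "HF_ord (range t) \<le> H"
    and "order_ideal_enum t'"
    and "HF_ord (range t') = H"
  shows "(dfb_sub t b (range t') :: ('m \<times> 'b, 'k) mpoly set set) =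
           HF_closed_sub t b H - zero_locus pring (J_ideal t b t' H)
       \<and> HF_closed_sub t b H - zero_locus pring (J_ideal t b t' H) =
           (HF_sub t b H - zero_locus pring {T_det t b t'} :: ('m \<times> 'b, 'k) mpoly set set)"
proof -
  interpret filtered_basis_scheme t b "TYPE('k)" t' H
    using assms by unfold_locales auto
  show ?thesis
    unfolding dfb_sub_eq HF_closed_sub_eq[OF length_bound_H] zero_locus_J HF_sub_eq by blast
qed

end
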